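(* Let $d\ge2$, $m>1$ and $1\le p\le d$. Then there exists a sequence of vector fields $\{\nabla\Phi_A(x)\}_{A\in\mathbb{N}}$ on $\mathbb{R}^d$ which are uniformly bounded in $L^p(\mathbb{R}^d)$ such that the following holds. Let $u_A$ solve $$u_t=\Delta u^m+\nabla\cdot(u\nabla\Phi_A)\quad\text{in }\mathbb{R}^d\times[0,\infty)$$ with a smooth, compactly supported, nonnegative and not identically zero initial datum $u_0$. Then $$\sup_{x\in\mathbb{R}^d,\,t>0}u_A(x,t)\to\infty\quad\text{as }A\to\infty .$$
   Context: Solutions are nonnegative weak solutions (with $V=\nabla\Phi_A$) on $\mathbb{R}^d\times[0,T]$ for every $T>0$: $u\in C([0,T],L^1(\mathbb{R}^d))\cap L^\infty(\mathbb{R}^d\times[0,T])$, $uV\in L^2(\mathbb{R}^d\times[0,T])$, $u^m\in L^2(0,T;\dot H^1(\mathbb{R}^d))$, and for all $\phi\in C_c^\infty(\mathbb{R}^d\times[0,T))$ $$\int_0^T\!\!\int u\,\phi_t\,dxdt=-\int u_0(x)\phi(x,0)\,dx+\int_0^T\!\!\int(\nabla u^m+uV)\cdot\nabla\phi\,dxdt .$$ *)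

theory Defs
  imports "HOL-Analysis.Analysis" "HOL-Probability.Essential_Supremum"
begin

primrec Ck :: "nat \<Rightarrow> ('a::euclidean_space \<Rightarrow> real) \<Rightarrow> bool" where
  "Ck 0 f \<longleftrightarrow> continuous_on UNIV f"
| "Ck (Suc k) f \<longleftrightarrow> f differentiable_on UNIV \<and>
     (\<forall>b\<in>Basis. Ck k (\<lambda>x. frechet_derivative f (at x) b))"

definition smooth :: "('a::euclidean_space \<Rightarrow> real) \<Rightarrow> bool" where
  "smooth f \<longleftrightarrow> (\<forall>k. Ck k f)"

definition supp :: "('a::topological_space \<Rightarrow> real) \<Rightarrow> 'a set" where
  "supp f = closure {x. f x \<noteq> 0}"

(* The classical gradient. For Lipschitz f it exists off a null set (Rademacher) and
   coincides a.e. with the weak gradient; its values on the null set are irrelevant below. *)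
definition grad :: "('a::euclidean_space \<Rightarrow> real) \<Rightarrow> 'a \<Rightarrow> 'a" where
  "grad f x = (\<Sum>b\<in>Basis. frechet_derivative f (at x) b *\<^sub>R b)"

definition in_Lp :: "real \<Rightarrow> 'a::euclidean_space set \<Rightarrow> ('a \<Rightarrow> 'b::euclidean_space) \<Rightarrow> bool" where
  "in_Lp p S f \<longleftrightarrow> set_borel_measurable lebesgue S f \<and>
     set_integrable lebesgue S (\<lambda>x. norm (f x) powr p)"

definition Lp_norm :: "real \<Rightarrow> 'a::euclidean_space set \<Rightarrow> ('a \<Rightarrow> 'b::euclidean_space) \<Rightarrow> real" where
  "Lp_norm p S f = (LINT x:S|lebesgue. norm (f x) powr p) powr (1 / p)"

definition locally_integrable :: "('a::euclidean_space \<Rightarrow> 'b::euclidean_space) \<Rightarrow> bool" where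
  "locally_integrable f \<longleftrightarrow> (\<forall>K. compact K \<longrightarrow> set_integrable lebesgue K f)"

definition has_weak_grad :: "('a::euclidean_space \<Rightarrow> real) \<Rightarrow> ('a \<Rightarrow> 'a) \<Rightarrow> bool" where
  "has_weak_grad f g \<longleftrightarrow> locally_integrable f \<and> locally_integrable g \<and>
     (\<forall>\<psi>. smooth \<psi> \<and> compact (supp \<psi>) \<longrightarrow>
        (LINT x|lebesgue. f x *\<^sub>R grad \<psi> x) = - (LINT x|lebesgue. \<psi> x *\<^sub>R g x))"

definition continuous_L1 :: "real \<Rightarrow> (real \<Rightarrow> 'a::euclidean_space \<Rightarrow> real) \<Rightarrow> bool" where
  "continuous_L1 T u \<longleftrightarrow> (\<forall>t\<in>{0..T}. integrable lebesgue (u t) \<and>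
     ((\<lambda>s. LINT x|lebesgue. \<bar>u s x - u t x\<bar>) \<longlongrightarrow> 0) (at t within {0..T}))"

(* Nonnegative weak solutions of u_t = Laplacian(u^m) + div(u V) on R^d x [0,T] with datum u0.
   Points of space-time are ordered (t, x). G is the spatial weak gradient of u^m, so the clauses
   about G say u^m is in L^2(0,T; H^1-dot). Elements of C_c^infinity(R^d x [0,T)), which need not
   vanish at t = 0, are taken as restrictions of smooth compactly supported functions on all of
   space-time whose support lies in t < T. *)
definition weak_solution_upto ::
  "real \<Rightarrow> real \<Rightarrow> ('a::euclidean_space \<Rightarrow> 'a) \<Rightarrow> ('a \<Rightarrow> real) \<Rightarrow> (real \<Rightarrow> 'a \<Rightarrow> real) \<Rightarrow> bool" where
  "weak_solution_upto T m V u0 u \<longleftrightarrow>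
     continuous_L1 T u \<and>
     set_borel_measurable lebesgue ({0..T} \<times> UNIV) (\<lambda>(t, x). u t x) \<and>
     (AE (t, x) in lebesgue. t \<in> {0..T} \<longrightarrow> 0 \<le> u t x) \<and>
     (\<exists>K. AE (t, x) in lebesgue. t \<in> {0..T} \<longrightarrow> \<bar>u t x\<bar> \<le> K) \<and>
     in_Lp 2 ({0..T} \<times> UNIV) (\<lambda>(t, x). u t x *\<^sub>R V x) \<and>
     (\<exists>G. in_Lp 2 ({0..T} \<times> UNIV) (\<lambda>(t, x). G t x) \<and>
        (AE t in lebesgue. t \<in> {0..T} \<longrightarrow> has_weak_grad (\<lambda>x. u t x powr m) (G t)) \<and>
        (\<forall>\<phi> :: real \<times> 'a \<Rightarrow> real.
           smooth \<phi> \<and> compact (supp \<phi>) \<and> supp \<phi> \<subseteq> {..<T} \<times> UNIV \<longrightarrow>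
           (LINT (t, x):{0..T} \<times> UNIV|lebesgue. u t x * deriv (\<lambda>s. \<phi> (s, x)) t)
           = - (LINT x|lebesgue. u0 x * \<phi> (0, x))
             + (LINT (t, x):{0..T} \<times> UNIV|lebesgue.
                  (G t x + u t x *\<^sub>R V x) \<bullet> grad (\<lambda>y. \<phi> (t, y)) x)))"

definition weak_solution ::
  "real \<Rightarrow> ('a::euclidean_space \<Rightarrow> 'a) \<Rightarrow> ('a \<Rightarrow> real) \<Rightarrow> (real \<Rightarrow> 'a \<Rightarrow> real) \<Rightarrow> bool" where
  "weak_solution m V u0 u \<longleftrightarrow> (\<forall>T>0. weak_solution_upto T m V u0 u)"

(* The supremum of u over x and t > 0, for u understood up to null sets. *)
definition sup_positive_times :: "(real \<Rightarrow> 'a::euclidean_space \<Rightarrow> real) \<Rightarrow> ereal" where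
  "sup_positive_times u =
     esssup (restrict_space lebesgue ({0<..} \<times> UNIV)) (\<lambda>(t, x). ereal (u t x))"

end

theory Submission
  imports Defs
begin

text \<open>
The drift is that of the logarithmic well \<open>\<Phi> = b ln (min 1 (|x|\<^sup>2 + \<epsilon>))\<close> with \<open>b = 1/n\<close> and
\<open>\<epsilon> = exp (- n^d)\<close>. The field has size about \<open>2b/|x|\<close> for \<open>\<surd>\<epsilon> < |x| < 1\<close>, so the \<open>d\<close>-th power of its
\<open>L\<^sup>d\<close> norm is of order \<open>b^d ln (1/\<epsilon>) = 1\<close>, whereas \<open>b ln (1/\<epsilon>) = n^(d-1)\<close> diverges.

Suppose \<open>0 \<le> u \<le> M\<close> and let \<open>\<psi>(x) = H(|x|\<^sup>2)\<close> be a compactly supported test function, decreasing in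
\<open>|x|\<close>, with \<open>-H'(\<sigma>) = (\<sigma> + \<epsilon>)^(-a)\<close> times a cutoff, where \<open>a\<close> lies below the harmonic exponent
\<open>d/2\<close> by \<open>b / (2 M^(m-1))\<close>. The cutoff makes \<open>\<psi>\<close> strictly subharmonic away from the origin, and inside
the unit ball the drift term compensates what is lost in the exponent, except on a core of radius about
\<open>\<surd>(\<epsilon>/b)\<close> whose contribution is exponentially small in \<open>n\<close>. A function bounded by \<open>M\<close> cannot store a fixed
amount of \<open>\<integral> u \<psi>\<close> near the origin, so \<open>\<integral> u \<psi>\<close> would satisfy \<open>y' \<ge> c y - e\<close> with \<open>e/c\<close> much smaller than
\<open>y(0)\<close>. It would grow exponentially, contradicting \<open>\<integral> u \<psi> \<le> M \<integral> \<psi>\<close>.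
\<close>

section \<open>Smooth functions\<close>

text \<open>The order of the constants shapes the proof. The radius \<open>R\<close>, the tolerances
  \<open>\<eta>\<close> and \<open>\<delta>\<close> and the rate \<open>c\<close> are fixed from the
  dimension, \<open>m\<close>, \<open>M\<close> and \<open>u0\<close>; only then does
  \<open>n\<close> grow. As \<open>\<psi>\<close> changes with \<open>n\<close>, its mass needs
  bounds from both sides that are uniform in \<open>a\<close> and \<open>\<epsilon>\<close>.
  Diffusion scales like \<open>u powr m\<close>, drift like \<open>u\<close>, so their weights
  differ by a factor of at most \<open>k = M powr (m - 1)\<close>; hence the offset
  \<open>al = b / (2 * k)\<close>. It pays for the core: the error density there is of order
  \<open>\<epsilon> powr (- a)\<close> and the volume of order
  \<open>(n * \<epsilon>) powr (d / 2)\<close>, so up to powers of \<open>n\<close> the product is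
  \<open>\<epsilon> powr al = exp (- n^(d-1) / (2 * k))\<close>. This is how the divergence of
  \<open>b * ln (1 / \<epsilon>)\<close> is used. Two degeneracies stand against y' \<ge> c y - e:
  the diffusion is weak where \<open>u\<close> is small, and the subharmonicity gained from the
  cutoff carries a factor |x|^2 that vanishes at the origin. They cost \<open>\<eta>\<close> times
  the mass of \<open>\<psi>\<close>, and \<open>M\<close> times its mass in |x|^2 <
  \<open>\<delta>\<close>.\<close>

lemma differentiable_on_UNIV_has_derivative:
  "f differentiable_on UNIV \<Longrightarrow> (f has_derivative frechet_derivative f (at x)) (at x)"
  by (simp add: differentiable_on_def frechet_derivative_works)

lemma Ck_SucI:
  assumes "\<And>x. (f has_derivative f' x) (at x)" and "\<And>b. b \<in> Basis \<Longrightarrow> Ck k (\<lambda>x. f' x b)"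
  shows "Ck (Suc k) f"
proof -
  have "frechet_derivative f (at x) = f' x" for x
    using assms(1) frechet_derivative_at by metis
  moreover have "f differentiable_on UNIV"
    using assms(1) by (auto simp: differentiable_on_def differentiable_def)
  ultimately show ?thesis using assms(2) by simp
qed

lemma Ck_Suc_imp_Ck: "Ck (Suc k) f \<Longrightarrow> Ck k f"
proof (induction k arbitrary: f)
  case 0
  then show ?case by (simp add: differentiable_imp_continuous_on)
next
  case (Suc k)
  then show ?case by (metis Ck.simps(2))
qed

lemma smooth_imp_Ck: "smooth f \<Longrightarrow> Ck k f"
  by (simp add: smooth_def)

lemma smoothI: "(\<And>k. Ck k f) \<Longrightarrow> smooth f"
  by (simp add: smooth_def)

lemma smooth_has_derivative:
  assumes "smooth f"
  shows "(f has_derivative frechet_derivative f (at x)) (at x)"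
  using smooth_imp_Ck[OF assms, of "Suc 0"] differentiable_on_UNIV_has_derivative by auto

lemma smooth_continuous_on: "smooth f \<Longrightarrow> continuous_on S f"
  using smooth_imp_Ck[of f 0] continuous_on_subset by auto

lemma smooth_frechet_derivative:
  "smooth f \<Longrightarrow> b \<in> Basis \<Longrightarrow> smooth (\<lambda>x. frechet_derivative f (at x) b)"
  using smooth_imp_Ck[of f "Suc _"] by (auto intro: smoothI)

lemma Ck_const: "Ck k (\<lambda>x. c)"
proof (induction k arbitrary: c)
  case (Suc k)
  show ?case by (rule Ck_SucI[where f'="\<lambda>x v. 0"]) (auto simp: Suc)
qed simp

lemma Ck_bounded_linear:
  assumes "bounded_linear f"
  shows "Ck k f"
proof (cases k)
  case 0
  then show ?thesis using linear_continuous_on[OF assms] by simp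
next
  case (Suc l)
  show ?thesis unfolding Suc
    by (rule Ck_SucI[where f'="\<lambda>x. f"]) (auto intro: Ck_const bounded_linear_imp_has_derivative assms)
qed

lemma Ck_add:
  "Ck k f \<Longrightarrow> Ck k g \<Longrightarrow> Ck k (\<lambda>x. f x + g x)"
proof (induction k arbitrary: f g)
  case 0
  then show ?case by (auto intro: continuous_on_add)
next
  case (Suc k)
  show ?case
    by (rule Ck_SucI[where f'="\<lambda>x v. frechet_derivative f (at x) v + frechet_derivative g (at x) v"])
      (use Suc in \<open>auto intro!: has_derivative_add differentiable_on_UNIV_has_derivative\<close>)
qed

lemma Ck_mult:
  "Ck k f \<Longrightarrow> Ck k g \<Longrightarrow> Ck k (\<lambda>x. f x * g x)"
proof (induction k arbitrary: f g)
  case 0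
  then show ?case by (auto intro: continuous_on_mult)
next
  case (Suc k)
  then have "Ck k f" "Ck k g" by (auto intro: Ck_Suc_imp_Ck)
  with Suc show ?case
    by (intro Ck_SucI[where f'="\<lambda>x v. f x * frechet_derivative g (at x) v + frechet_derivative f (at x) v * g x"])
      (auto intro!: has_derivative_mult differentiable_on_UNIV_has_derivative Ck_add)
qed

lemma Ck_sum:
  "finite S \<Longrightarrow> (\<And>i. i \<in> S \<Longrightarrow> Ck k (f i)) \<Longrightarrow> Ck k (\<lambda>x. \<Sum>i\<in>S. f i x)"
  by (induction S rule: finite_induct) (auto intro: Ck_const Ck_add)

lemma smooth_const: "smooth (\<lambda>x. c)"
  and smooth_bounded_linear: "bounded_linear f \<Longrightarrow> smooth f"
  and smooth_add: "smooth f \<Longrightarrow> smooth g \<Longrightarrow> smooth (\<lambda>x. f x + g x)"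
  and smooth_mult: "smooth f \<Longrightarrow> smooth g \<Longrightarrow> smooth (\<lambda>x. f x * g x)"
  and smooth_sum: "finite S \<Longrightarrow> (\<And>i. i \<in> S \<Longrightarrow> smooth (h i)) \<Longrightarrow> smooth (\<lambda>x. \<Sum>i\<in>S. h i x)"
  by (simp_all add: smooth_def Ck_const Ck_bounded_linear Ck_add Ck_mult Ck_sum)

lemma smooth_inner_self: "smooth (\<lambda>x::'a::euclidean_space. x \<bullet> x)"
proof -
  have "smooth (\<lambda>x::'a. \<Sum>b\<in>Basis. (x \<bullet> b) * (x \<bullet> b))"
    by (intro smooth_sum smooth_mult smooth_bounded_linear bounded_linear_inner_left) simp
  then show ?thesis by (simp add: euclidean_inner[symmetric])
qed

lemma has_derivative_compose_real:
  fixes f :: "'a::euclidean_space \<Rightarrow> real"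
  assumes "(h has_real_derivative h') (at (f x))" and "(f has_derivative f') (at x)"
  shows "((\<lambda>x. h (f x)) has_derivative (\<lambda>v. h' * f' v)) (at x)"
  using has_derivative_compose[OF assms(2) assms(1)[unfolded has_field_derivative_def]] by (simp add: o_def)

text \<open>Made for a function known only through its derivative, such as the integral
  \<open>H\<close> below. Smoothness of \<open>h'\<close> is required only after composition with
  \<open>f\<close>, because the profile \<open>P\<close> is differentiated only on the half-line
  that contains the values of \<open>x \<bullet> x\<close>.\<close>

lemma smooth_compose_antiderivative:
  assumes f: "smooth f" and h: "\<And>x. (h has_real_derivative h' (f x)) (at (f x))"
    and h': "smooth (\<lambda>x. h' (f x))"
  shows "smooth (\<lambda>x. h (f x))"
proof (rule smoothI)
  fix k
  have "Ck (Suc k) (\<lambda>x. h (f x))"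
    by (rule Ck_SucI[OF has_derivative_compose_real[OF h smooth_has_derivative[OF f]]])
      (intro Ck_mult smooth_imp_Ck h' smooth_frechet_derivative f)
  then show "Ck k (\<lambda>x. h (f x))" by (rule Ck_Suc_imp_Ck)
qed

lemma smooth_exp:
  assumes f: "smooth f"
  shows "smooth (\<lambda>x. exp (f x))"
proof (rule smoothI)
  fix k show "Ck k (\<lambda>x. exp (f x))"
  proof (induction k)
    case 0
    then show ?case using smooth_continuous_on[OF f] by (auto intro: continuous_on_exp)
  next
    case (Suc k)
    show ?case
      by (rule Ck_SucI[OF has_derivative_compose_real[OF DERIV_exp smooth_has_derivative[OF f]]])
        (intro Ck_mult smooth_imp_Ck smooth_frechet_derivative f Suc)
  qed
qed

lemma smooth_powr:
  assumes f: "smooth f" and pos: "\<And>x. 0 < f x"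
  shows "smooth (\<lambda>x. f x powr r)"
proof (rule smoothI)
  fix k show "Ck k (\<lambda>x. f x powr r)"
  proof (induction k arbitrary: r)
    case 0
    then show ?case using smooth_continuous_on[OF f] pos
      by (auto intro!: continuous_on_powr simp: less_imp_neq[OF pos, symmetric])
  next
    case (Suc k)
    have der: "((\<lambda>z. z powr r) has_real_derivative r * f x powr (r - 1)) (at (f x))" for x
      by (rule has_real_derivative_powr[OF pos])
    show ?case
      by (rule Ck_SucI[OF has_derivative_compose_real[OF der smooth_has_derivative[OF f]]])
        (intro Ck_mult Ck_const smooth_imp_Ck smooth_frechet_derivative f Suc)
  qed
qed

text \<open>The functions \<open>q(1/z) exp(-1/z)\<close>, extended by zero, are closed under differentiation.\<close>

definition flat :: "real poly \<Rightarrow> real \<Rightarrow> real" where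
  "flat q z = (if 0 < z then poly q (1 / z) * exp (- (1 / z)) else 0)"

abbreviation bump :: "real \<Rightarrow> real" where
  "bump \<equiv> flat 1"

lemma tendsto_poly_exp: "((\<lambda>w::real. poly q w * exp (- w)) \<longlongrightarrow> 0) at_top"
proof -
  have "((\<lambda>w::real. \<Sum>i\<le>degree q. coeff q i * (w ^ i / exp w)) \<longlongrightarrow> (\<Sum>i\<le>degree q. coeff q i * 0)) at_top"
    by (intro tendsto_sum tendsto_mult tendsto_const tendsto_power_div_exp_0)
  then show ?thesis
    by (simp add: poly_altdef sum_distrib_right exp_minus divide_inverse mult.assoc)
qed

text \<open>With w = 1/z, differentiation in z is -w^2 times differentiation in w, which turns q(w)
  exp(-w) into w^2 (q(w) - q'(w)) exp(-w). At z = 0 the exponential beats every polynomial.\<close>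

lemma flat_has_derivative:
  "(flat q has_real_derivative flat (monom 1 2 * (q - pderiv q)) z) (at z)"
proof (cases "z = 0")
  case False
  show ?thesis
  proof (cases "0 < z")
    case True
    have "((\<lambda>z. poly q (1 / z) * exp (- (1 / z))) has_real_derivative
        flat (monom 1 2 * (q - pderiv q)) z) (at z)"
      using True
      by (auto intro!: derivative_eq_intros poly_DERIV[THEN DERIV_chain2]
          simp: flat_def poly_monom field_simps power2_eq_square)
    then show ?thesis
      by (rule has_field_derivative_transform_within_open[OF _ open_greaterThan[of 0]])
        (use True in \<open>auto simp: flat_def\<close>)
  next
    case F: False
    have "((\<lambda>z. 0) has_real_derivative flat (monom 1 2 * (q - pderiv q)) z) (at z)"
      using F by (simp add: flat_def)
    then show ?thesis
      by (rule has_field_derivative_transform_within_open[OF _ open_lessThan[of 0]])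
        (use False F in \<open>auto simp: flat_def\<close>)
  qed
next
  case True
  have "((\<lambda>z. flat q z / z) \<longlongrightarrow> 0) (at_right 0)"
  proof -
    \<comment> \<open>The division by z in the difference quotient is one more factor 1/z, that is,
      the polynomial \<open>pCons 0 q\<close>.\<close>
    have "((\<lambda>z. poly (pCons 0 q) (inverse z) * exp (- inverse z)) \<longlongrightarrow> 0) (at_right (0::real))"
      by (rule filterlim_compose[OF tendsto_poly_exp filterlim_inverse_at_top_right])
    then show ?thesis
      by (rule Lim_transform_eventually)
        (auto simp: flat_def eventually_at_right_less field_simps intro!: eventually_at_rightI[of 0 1])
  qed
  moreover have "((\<lambda>z. flat q z / z) \<longlongrightarrow> 0) (at_left 0)"
    by (rule Lim_transform_eventually[OF tendsto_const])
      (auto simp: flat_def intro!: eventually_at_leftI[of "-1"])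
  ultimately have "((\<lambda>z. flat q z / z) \<longlongrightarrow> 0) (at 0)"
    by (simp add: filterlim_split_at)
  then show ?thesis
    using True by (simp add: has_field_derivative_iff flat_def)
qed

lemma smooth_flat:
  assumes f: "smooth f"
  shows "smooth (\<lambda>x. flat q (f x))"
proof (rule smoothI)
  fix k show "Ck k (\<lambda>x. flat q (f x))"
  proof (induction k arbitrary: q)
    case 0
    have "continuous_on UNIV (flat q)"
      by (meson DERIV_isCont continuous_at_imp_continuous_on flat_has_derivative)
    then show ?case using smooth_continuous_on[OF f]
      by (auto intro: continuous_on_compose2)
  next
    case (Suc k)
    show ?case
      by (rule Ck_SucI[OF has_derivative_compose_real[OF flat_has_derivative smooth_has_derivative[OF f]]])
        (intro Ck_mult smooth_imp_Ck smooth_frechet_derivative f Suc)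
  qed
qed

lemma smooth_compose_bounded_linear:
  fixes f :: "'a::euclidean_space \<Rightarrow> real" and l :: "'b::euclidean_space \<Rightarrow> 'a"
  assumes f: "smooth f" and l: "bounded_linear l"
  shows "smooth (\<lambda>x. f (l x))"
proof (rule smoothI)
  fix k show "Ck k (\<lambda>x. f (l x))"
    using f
  proof (induction k arbitrary: f)
    case 0
    then show ?case using smooth_continuous_on[OF 0] linear_continuous_on[OF l]
      by (auto intro: continuous_on_compose2)
  next
    case (Suc k)
    have der: "((\<lambda>x. f (l x)) has_derivative (\<lambda>v. frechet_derivative f (at (l x)) (l v))) (at x)" for x
      using has_derivative_compose[OF bounded_linear_imp_has_derivative[OF l] smooth_has_derivative[OF Suc.prems]] .
    \<comment> \<open>The image \<open>l b\<close> of a basis vector need not be a basis vector,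
      while \<open>Ck\<close> speaks only of derivatives along \<open>Basis\<close>.\<close>
    have exp: "frechet_derivative f (at y) w = (\<Sum>c\<in>Basis. (w \<bullet> c) * frechet_derivative f (at y) c)" for y w
    proof -
      have "linear (frechet_derivative f (at y))"
        using has_derivative_linear[OF smooth_has_derivative[OF Suc.prems]] .
      then have "frechet_derivative f (at y) (\<Sum>c\<in>Basis. (w \<bullet> c) *\<^sub>R c) = (\<Sum>c\<in>Basis. (w \<bullet> c) * frechet_derivative f (at y) c)"
        by (simp add: linear_sum linear_cmul)
      then show ?thesis by (simp add: euclidean_representation)
    qed
    show ?case
    proof (rule Ck_SucI[OF der])
      fix b :: 'b assume "b \<in> Basis"
      show "Ck k (\<lambda>x. frechet_derivative f (at (l x)) (l b))"
        unfolding exp[of _ "l b"]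
        by (intro Ck_sum Ck_mult Ck_const Suc.IH smooth_frechet_derivative Suc.prems) simp
    qed
  qed
qed

section \<open>Weak gradients and Fubini for the Lebesgue measure\<close>

text \<open>Completeness of the measure: only \<open>g\<close> is assumed measurable. This is what
  lets \<open>grad\<close>, known explicitly only off a null set, enter integrals.\<close>

lemma lebesgue_measurable_cong_AE:
  fixes f g :: "'a::euclidean_space \<Rightarrow> 'b::topological_space"
  assumes g: "g \<in> borel_measurable lebesgue" and fg: "AE x in lebesgue. f x = g x"
  shows "f \<in> borel_measurable lebesgue"
proof (rule measurableI)
  fix B :: "'b set" assume "B \<in> sets borel"
  then have B: "g -` B \<inter> space lebesgue \<in> sets lebesgue" using g by (rule measurable_sets[rotated])
  have "AE x in lebesgue. x \<in> g -` B \<inter> space lebesgue \<longleftrightarrow> x \<in> f -` B \<inter> space lebesgue"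
    using fg by eventually_elim auto
  from completion.in_sets_AE[OF this B] show "f -` B \<inter> space lebesgue \<in> sets lebesgue" by simp
qed simp

lemma lebesgue_integrable_cong_AE:
  fixes f g :: "'a::euclidean_space \<Rightarrow> real"
  assumes g: "integrable lebesgue g" and fg: "AE x in lebesgue. f x = g x"
  shows "integrable lebesgue f" and "integral\<^sup>L lebesgue f = integral\<^sup>L lebesgue g"
proof -
  have f: "f \<in> borel_measurable lebesgue"
    using lebesgue_measurable_cong_AE[OF borel_measurable_integrable[OF g] fg] .
  show "integrable lebesgue f"
    using integrable_cong_AE[OF f borel_measurable_integrable[OF g] fg] g by simp
  show "integral\<^sup>L lebesgue f = integral\<^sup>L lebesgue g"
    by (rule integral_cong_AE[OF f borel_measurable_integrable[OF g] fg])
qed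

text \<open>The completed measure on the product is not the product of the completed measures, so
  Fubini is applied to a Borel function \<open>g\<close> that agrees with \<open>f\<close> almost
  everywhere. Almost every slice of \<open>f\<close> then agrees almost everywhere with that of
  \<open>g\<close>.\<close>

lemma
  fixes f :: "'a::euclidean_space \<times> 'b::euclidean_space \<Rightarrow> real"
  assumes f: "integrable lebesgue f"
  shows integrable_lebesgue_fst: "integrable lebesgue (\<lambda>t. LINT x|lebesgue. f (t, x))"
    and integral_lebesgue_fst: "(LINT t|lebesgue. LINT x|lebesgue. f (t, x)) = integral\<^sup>L lebesgue f"
proof -
  obtain g where g[measurable]: "g \<in> borel_measurable lborel" and fg: "AE z in lborel. f z = g z"
    using completion_ex_borel_measurable_real[OF borel_measurable_integrable[OF f]] by auto
  have fg': "AE z in lebesgue. f z = g z" using fg by (rule AE_completion)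
  have "integrable lebesgue g"
    by (rule lebesgue_integrable_cong_AE(1)[OF f]) (use fg' in auto)
  then have g_int: "integrable (lborel \<Otimes>\<^sub>M lborel) g"
    by (simp add: integrable_completion lborel_prod)
  have slice: "AE t in lebesgue. AE x in lebesgue. f (t, x) = g (t, x)"
    unfolding AE_completion_iff by (rule lborel_pair.AE_pair) (use fg in \<open>simp only: lborel_prod\<close>)
  have g_meas: "(\<lambda>x. g (t, x)) \<in> borel_measurable lborel" for t by measurable
  have g_slice: "AE t in lebesgue. integrable lebesgue (\<lambda>x. g (t, x))"
    unfolding AE_completion_iff integrable_completion[OF g_meas]
    by (rule lborel_pair.AE_integrable_fst'[OF g_int])
  have both: "AE t in lebesgue. integrable lebesgue (\<lambda>x. f (t, x)) \<and>
      (LINT x|lebesgue. f (t, x)) = (LINT x|lebesgue. g (t, x))"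
    using g_slice slice
  proof eventually_elim
    case (elim t)
    show ?case using lebesgue_integrable_cong_AE[OF elim] by (intro conjI)
  qed
  have gt: "(LINT x|lebesgue. g (t, x)) = (LINT x|lborel. g (t, x))" for t
    by (rule integral_completion) measurable
  have g1: "integrable lebesgue (\<lambda>t. LINT x|lebesgue. g (t, x))"
    unfolding gt using lborel_pair.integrable_fst'[OF g_int]
    by (simp add: integrable_completion borel_measurable_integrable)
  have "AE t in lebesgue. (LINT x|lebesgue. f (t, x)) = (LINT x|lebesgue. g (t, x))"
    using both by eventually_elim simp
  note c = lebesgue_integrable_cong_AE[OF g1 this]
  show "integrable lebesgue (\<lambda>t. LINT x|lebesgue. f (t, x))" by (rule c)
  have "(LINT t|lebesgue. LINT x|lebesgue. g (t, x)) = (LINT t|lborel. LINT x|lborel. g (t, x))"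
    unfolding gt using borel_measurable_integrable[OF lborel_pair.integrable_fst'[OF g_int]]
    by (rule integral_completion)
  also have "\<dots> = integral\<^sup>L lborel g"
    using lborel_pair.integral_fst'[OF g_int] by (simp add: lborel_prod)
  also have "\<dots> = integral\<^sup>L lebesgue g" by (rule integral_completion[symmetric]) simp
  also have "\<dots> = integral\<^sup>L lebesgue f"
    by (rule lebesgue_integrable_cong_AE(2)[symmetric]) (use fg' \<open>integrable lebesgue g\<close> in auto)
  finally show "(LINT t|lebesgue. LINT x|lebesgue. f (t, x)) = integral\<^sup>L lebesgue f"
    using c(2) by simp
qed

text \<open>The cylinder over a null set has measure \<infinity> times 0, which is 0. It carries the
  inequality in x alone over to space-time.\<close>

lemma AE_lebesgue_snd:
  assumes "AE x in (lebesgue :: 'b::euclidean_space measure). P x"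
  shows "AE z in (lebesgue :: ('a::euclidean_space \<times> 'b) measure). P (snd z)"
proof -
  obtain N where N: "{x \<in> space lborel. \<not> P x} \<subseteq> N" "emeasure lborel N = 0" "N \<in> sets (lborel :: 'b measure)"
    using assms unfolding AE_completion_iff by (rule AE_E)
  have [measurable]: "N \<in> sets borel" using N by simp
  have "emeasure (lborel \<Otimes>\<^sub>M lborel) ((UNIV :: 'a set) \<times> N) = emeasure (lborel :: 'a measure) UNIV * emeasure lborel N"
    by (rule lborel.emeasure_pair_measure_Times) auto
  then have "emeasure (lborel :: ('a \<times> 'b) measure) (UNIV \<times> N) = 0"
    using N by (simp add: lborel_prod)
  moreover have "UNIV \<times> N \<in> sets (lborel :: ('a \<times> 'b) measure)" by (simp add: borel_Times)
  ultimately have "AE z in (lborel :: ('a \<times> 'b) measure). P (snd z)"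
    using N(1) by (intro AE_I[of _ _ "UNIV \<times> N"]) auto
  then show ?thesis by (rule AE_completion)
qed

section \<open>Integrability against compactly supported functions\<close>

lemma integrable_continuous_compact_support:
  fixes g :: "'a::euclidean_space \<Rightarrow> real"
  assumes "continuous_on UNIV g" and "compact K" and "\<And>x. x \<notin> K \<Longrightarrow> g x = 0"
  shows "integrable lebesgue g"
proof -
  have "integrable lborel (\<lambda>x. indicator K x *\<^sub>R g x)"
    using assms by (intro borel_integrable_compact) (auto intro: continuous_on_subset)
  moreover have "(\<lambda>x. indicator K x *\<^sub>R g x) = g"
    using assms(3) by (auto simp: fun_eq_iff indicator_def)
  ultimately show ?thesis
    using borel_measurable_integrable by (subst integrable_completion) auto
qed

lemma continuous_compact_support_bounded:
  fixes g :: "'a::euclidean_space \<Rightarrow> 'b::real_normed_vector"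
  assumes "continuous_on UNIV g" and "compact K" and "\<And>x. x \<notin> K \<Longrightarrow> g x = 0"
  obtains C where "C \<ge> 0" "\<And>x. norm (g x) \<le> C"
proof -
  have "compact (g ` K)" using assms by (intro compact_continuous_image) (auto intro: continuous_on_subset)
  then obtain C where "\<forall>y\<in>g ` K. norm y \<le> C" using compact_imp_bounded bounded_iff by metis
  then have "norm (g x) \<le> max C 0" for x using assms(3)[of x] by (cases "x \<in> K") auto
  then show ?thesis using that[of "max C 0"] by auto
qed

lemma continuous_on_UNIV_measurable_lebesgue:
  "continuous_on UNIV g \<Longrightarrow> g \<in> borel_measurable lebesgue"
  by (intro measurable_completion) (simp add: borel_measurable_continuous_onI)

lemma locally_integrable_scaleR:
  fixes f :: "'a::euclidean_space \<Rightarrow> 'b::euclidean_space" and h :: "'a \<Rightarrow> real"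
  assumes f: "locally_integrable f" and h: "continuous_on UNIV h"
    and K: "compact K" "\<And>x. x \<notin> K \<Longrightarrow> h x = 0"
  shows "integrable lebesgue (\<lambda>x. h x *\<^sub>R f x)"
proof -
  obtain C where C: "C \<ge> 0" "\<And>x. norm (h x) \<le> C"
    using continuous_compact_support_bounded[OF h K] by blast
  have fK: "integrable lebesgue (\<lambda>x. indicator K x *\<^sub>R f x)"
    using f K(1) by (simp add: locally_integrable_def set_integrable_def)
  have eq: "(\<lambda>x. h x *\<^sub>R f x) = (\<lambda>x. h x *\<^sub>R indicator K x *\<^sub>R f x)"
    using K(2) by (auto simp: fun_eq_iff indicator_def)
  show ?thesis unfolding eq
  proof (rule Bochner_Integration.integrable_bound)
    show "integrable lebesgue (\<lambda>x. C * norm (indicator K x *\<^sub>R f x))"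
      by (intro integrable_mult_right integrable_norm fK)
    show "(\<lambda>x. h x *\<^sub>R indicator K x *\<^sub>R f x) \<in> borel_measurable lebesgue"
      using continuous_on_UNIV_measurable_lebesgue[OF h] borel_measurable_integrable[OF fK] by measurable
    show "AE x in lebesgue. norm (h x *\<^sub>R indicator K x *\<^sub>R f x) \<le> norm (C * norm (indicator K x *\<^sub>R f x))"
      by (intro AE_I2) (use C in \<open>auto simp: abs_mult mult.assoc intro!: mult_right_mono\<close>)
  qed
qed

section \<open>The Laplacian of a test function\<close>

definition lap :: "('a::euclidean_space \<Rightarrow> real) \<Rightarrow> 'a \<Rightarrow> real" where
  "lap f x = (\<Sum>b\<in>Basis. frechet_derivative (\<lambda>y. frechet_derivative f (at y) b) (at x) b)"

lemma notin_supp: "x \<notin> supp f \<Longrightarrow> f x = 0"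
  unfolding supp_def using closure_subset[of "{x. f x \<noteq> 0}"] by auto

lemma open_supp_complement: "open (- supp f)"
  by (simp add: supp_def open_Compl)

lemma frechet_derivative_notin_supp:
  assumes "x \<notin> supp f"
  shows "frechet_derivative f (at x) = (\<lambda>v. 0)"
proof -
  have "(f has_derivative (\<lambda>v. 0)) (at x)"
    by (rule has_derivative_transform_within_open[OF has_derivative_const, where s="- supp f"])
      (use assms in \<open>simp_all add: notin_supp open_supp_complement\<close>)
  then show ?thesis by (rule frechet_derivative_at[symmetric])
qed

lemma compact_supp_mono:
  assumes "compact (supp f)" and "\<And>x. x \<notin> supp f \<Longrightarrow> g x = 0"
  shows "compact (supp g)"
proof -
  have "{x. g x \<noteq> 0} \<subseteq> supp f" using assms(2) by auto
  then have "supp g \<subseteq> supp f"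
    unfolding supp_def[of g] by (rule closure_minimal) (simp add: supp_def)
  then show ?thesis using assms(1)
    by (metis closed_closure closed_Int_compact inf.absorb_iff1 supp_def)
qed

lemma grad_inner_Basis:
  "b \<in> Basis \<Longrightarrow> grad f x \<bullet> b = frechet_derivative f (at x) b"
  by (simp add: grad_def inner_sum_left inner_Basis if_distrib cong: if_cong)

lemma smooth_grad_continuous: "smooth f \<Longrightarrow> continuous_on S (grad f)"
  unfolding grad_def
  by (intro continuous_intros smooth_continuous_on smooth_frechet_derivative)

lemma smooth_lap_continuous: "smooth f \<Longrightarrow> continuous_on S (lap f)"
  unfolding lap_def
  by (intro continuous_intros smooth_continuous_on smooth_frechet_derivative)

lemma grad_notin_supp: "x \<notin> supp f \<Longrightarrow> grad f x = 0"
  by (simp add: grad_def frechet_derivative_notin_supp)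

lemma lap_notin_supp:
  assumes "x \<notin> supp f"
  shows "lap f x = 0"
proof -
  have "frechet_derivative (\<lambda>y. frechet_derivative f (at y) b) (at x) = (\<lambda>v. 0)" for b
  proof -
    have "((\<lambda>y. frechet_derivative f (at y) b) has_derivative (\<lambda>v. 0)) (at x)"
      by (rule has_derivative_transform_within_open[OF has_derivative_const, where s="- supp f"])
        (use assms in \<open>simp_all add: frechet_derivative_notin_supp open_supp_complement\<close>)
    then show ?thesis by (rule frechet_derivative_at[symmetric])
  qed
  then show ?thesis by (simp add: lap_def)
qed

text \<open>Each partial derivative of \<open>\<psi>\<close> is itself a test function. Testing the
  weak gradient with the one in direction \<open>b\<close>, taking the component along
  \<open>b\<close> and summing over \<open>b\<close> gives the Laplacian.\<close>

lemma has_weak_grad_lap: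
  assumes fg: "has_weak_grad f g" and \<psi>: "smooth \<psi>" "compact (supp \<psi>)"
  shows "(LINT x|lebesgue. f x * lap \<psi> x) = - (LINT x|lebesgue. g x \<bullet> grad \<psi> x)"
proof -
  define D where "D b x = frechet_derivative \<psi> (at x) b" for b x
  define DD where "DD b c x = frechet_derivative (D b) (at x) c" for b c x
  have lf: "locally_integrable f" and lg: "locally_integrable g" using fg by (auto simp: has_weak_grad_def)
  have D: "smooth (D b)" if "b \<in> Basis" for b
    unfolding D_def using smooth_frechet_derivative[OF \<psi>(1) that] by simp
  have D0: "D b x = 0" if "x \<notin> supp \<psi>" for b x
    using frechet_derivative_notin_supp[OF that] by (simp add: D_def)
  have cD: "compact (supp (D b))" for b by (rule compact_supp_mono[OF \<psi>(2) D0])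
  have DD: "smooth (DD b c)" if "b \<in> Basis" "c \<in> Basis" for b c
    unfolding DD_def using smooth_frechet_derivative[OF D that(2)] that(1) by simp
  have DD0: "DD b c x = 0" if "x \<notin> supp (D b)" for b c x
    using frechet_derivative_notin_supp[OF that] by (simp add: DD_def)
  have i1: "integrable lebesgue (\<lambda>x. f x * DD b c x)" if "b \<in> Basis" "c \<in> Basis" for b c
    using locally_integrable_scaleR[OF lf smooth_continuous_on[OF DD[OF that]] cD DD0]
    by (simp add: mult.commute)
  have i2: "integrable lebesgue (\<lambda>x. D b x *\<^sub>R g x)" if "b \<in> Basis" for b
    by (rule locally_integrable_scaleR[OF lg smooth_continuous_on[OF D[OF that]] \<psi>(2) D0])
  have i4: "integrable lebesgue (\<lambda>x. D b x * (g x \<bullet> b))" if "b \<in> Basis" for b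
  proof -
    have "integrable lebesgue (\<lambda>x. (D b x *\<^sub>R g x) \<bullet> b)"
      by (intro integrable_inner_left i2 that)
    then show ?thesis by simp
  qed
  have key: "(LINT x|lebesgue. f x * DD b b x) = - (LINT x|lebesgue. D b x * (g x \<bullet> b))" if b: "b \<in> Basis" for b
  proof -
    have gr: "f x *\<^sub>R grad (D b) x = (\<Sum>c\<in>Basis. (f x * DD b c x) *\<^sub>R c)" for x
      by (simp add: grad_def DD_def scaleR_sum_right)
    have i3: "integrable lebesgue (\<lambda>x. f x *\<^sub>R grad (D b) x)"
      unfolding gr by (intro Bochner_Integration.integrable_sum integrable_scaleR_left i1 b)
    have "(LINT x|lebesgue. f x *\<^sub>R grad (D b) x) = - (LINT x|lebesgue. D b x *\<^sub>R g x)"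
      using fg D[OF b] cD by (simp add: has_weak_grad_def)
    then have "(LINT x|lebesgue. f x *\<^sub>R grad (D b) x) \<bullet> b = - ((LINT x|lebesgue. D b x *\<^sub>R g x) \<bullet> b)"
      by simp
    then have "(LINT x|lebesgue. f x *\<^sub>R grad (D b) x \<bullet> b) = - (LINT x|lebesgue. D b x *\<^sub>R g x \<bullet> b)"
      by (subst (1 2) integral_inner_left) (use i3 i2[OF b] in auto)
    then show ?thesis using b by (simp add: grad_inner_Basis DD_def)
  qed
  have "(LINT x|lebesgue. f x * lap \<psi> x) = (LINT x|lebesgue. (\<Sum>b\<in>Basis. f x * DD b b x))"
    by (simp add: lap_def DD_def D_def[abs_def] sum_distrib_left)
  also have "\<dots> = (\<Sum>b\<in>Basis. (LINT x|lebesgue. f x * DD b b x))"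
    by (intro Bochner_Integration.integral_sum i1)
  also have "\<dots> = - (\<Sum>b\<in>Basis. (LINT x|lebesgue. D b x * (g x \<bullet> b)))"
    by (simp add: key sum_negf)
  also have "(\<Sum>b\<in>Basis. (LINT x|lebesgue. D b x * (g x \<bullet> b))) = (LINT x|lebesgue. (\<Sum>b\<in>Basis. D b x * (g x \<bullet> b)))"
    by (intro Bochner_Integration.integral_sum[symmetric] i4)
  also have "\<dots> = (LINT x|lebesgue. g x \<bullet> grad \<psi> x)"
    by (simp add: D_def grad_def inner_sum_right mult.commute)
  finally show ?thesis .
qed

section \<open>Separated test functions\<close>

text \<open>The product is dominated by the sum of the two squares; \<open>h\<close> is square
  integrable as a continuous function of compact support.\<close>

lemma in_Lp_2_inner_integrable:
  fixes F h :: "'a::euclidean_space \<Rightarrow> 'b::euclidean_space"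
  assumes F: "in_Lp 2 S F" and h: "continuous_on UNIV h"
    and K: "compact K" "\<And>z. z \<notin> K \<Longrightarrow> h z = 0"
  shows "integrable lebesgue (\<lambda>z. indicator S z * (F z \<bullet> h z))"
proof (rule Bochner_Integration.integrable_bound)
  have "integrable lebesgue (\<lambda>z. norm (h z) ^ 2)"
    by (rule integrable_continuous_compact_support[OF _ K(1)]) (auto intro!: continuous_intros h simp: K(2))
  moreover have "integrable lebesgue (\<lambda>z. indicator S z * norm (F z) powr 2)"
    using F by (simp add: in_Lp_def set_integrable_def)
  ultimately show "integrable lebesgue (\<lambda>z. indicator S z * norm (F z) powr 2 + norm (h z) ^ 2)"
    by (rule Bochner_Integration.integrable_add[rotated])
  have "(\<lambda>z. indicator S z *\<^sub>R F z) \<in> borel_measurable lebesgue"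
    using F by (simp add: in_Lp_def set_borel_measurable_def)
  then have "(\<lambda>z. (indicator S z *\<^sub>R F z) \<bullet> h z) \<in> borel_measurable lebesgue"
    using continuous_on_UNIV_measurable_lebesgue[OF h] by (rule borel_measurable_inner)
  then show "(\<lambda>z. indicator S z * (F z \<bullet> h z)) \<in> borel_measurable lebesgue" by simp
  have "\<bar>F z \<bullet> h z\<bar> \<le> norm (F z) ^ 2 + norm (h z) ^ 2" for z
    using Cauchy_Schwarz_ineq2[of "F z" "h z"] sum_squares_bound[of "norm (F z)" "norm (h z)"]
      mult_nonneg_nonneg[OF norm_ge_zero[of "F z"] norm_ge_zero[of "h z"]] by linarith
  then show "AE z in lebesgue. norm (indicator S z * (F z \<bullet> h z))
      \<le> norm (indicator S z * norm (F z) powr 2 + norm (h z) ^ 2)"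
    by (intro AE_I2) (auto simp: indicator_def)
qed

lemma bounded_mult_integrable:
  fixes w h :: "'a::euclidean_space \<Rightarrow> real"
  assumes w: "(\<lambda>z. indicator S z * w z) \<in> borel_measurable lebesgue"
    and bd: "AE z in lebesgue. z \<in> S \<longrightarrow> \<bar>w z\<bar> \<le> C"
    and h: "continuous_on UNIV h" and K: "compact K" "\<And>z. z \<notin> K \<Longrightarrow> h z = 0"
  shows "integrable lebesgue (\<lambda>z. indicator S z * (w z * h z))"
proof (rule Bochner_Integration.integrable_bound)
  show "integrable lebesgue (\<lambda>z. C * h z)"
    by (intro integrable_mult_right integrable_continuous_compact_support[OF h K])
  have "(\<lambda>z. (indicator S z * w z) * h z) \<in> borel_measurable lebesgue"
    using w continuous_on_UNIV_measurable_lebesgue[OF h] by (rule borel_measurable_times)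
  then show "(\<lambda>z. indicator S z * (w z * h z)) \<in> borel_measurable lebesgue" by (simp add: mult.assoc)
  show "AE z in lebesgue. norm (indicator S z * (w z * h z)) \<le> norm (C * h z)"
    using bd
  proof eventually_elim
    case (elim z)
    show ?case
    proof (cases "z \<in> S")
      case True
      then have "\<bar>w z\<bar> * \<bar>h z\<bar> \<le> \<bar>C\<bar> * \<bar>h z\<bar>" using elim by (intro mult_right_mono) auto
      then show ?thesis using True by (simp add: abs_mult)
    qed simp
  qed
qed

lemma supp_product:
  fixes \<theta> :: "'a::euclidean_space \<Rightarrow> real" and \<psi> :: "'b::euclidean_space \<Rightarrow> real"
  assumes "compact (supp \<theta>)" "compact (supp \<psi>)"
  shows "compact (supp (\<lambda>z. \<theta> (fst z) * \<psi> (snd z)))"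
    and "supp (\<lambda>z. \<theta> (fst z) * \<psi> (snd z)) \<subseteq> supp \<theta> \<times> supp \<psi>"
proof -
  have c: "compact (supp \<theta> \<times> supp \<psi>)" using assms by (rule compact_Times)
  have "{z. \<theta> (fst z) * \<psi> (snd z) \<noteq> 0} \<subseteq> supp \<theta> \<times> supp \<psi>"
    using notin_supp[of _ \<theta>] notin_supp[of _ \<psi>] by (auto simp: mem_Times_iff) blast+
  then show sub: "supp (\<lambda>z. \<theta> (fst z) * \<psi> (snd z)) \<subseteq> supp \<theta> \<times> supp \<psi>"
    unfolding supp_def[of "\<lambda>z. \<theta> (fst z) * \<psi> (snd z)"]
    by (rule closure_minimal) (rule compact_imp_closed[OF c])
  then have "supp (\<lambda>z. \<theta> (fst z) * \<psi> (snd z)) = supp (\<lambda>z. \<theta> (fst z) * \<psi> (snd z)) \<inter> (supp \<theta> \<times> supp \<psi>)"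
    by blast
  also have "compact \<dots>" using c by (intro closed_Int_compact) (simp_all add: supp_def)
  finally show "compact (supp (\<lambda>z. \<theta> (fst z) * \<psi> (snd z)))" .
qed

lemma grad_cmult:
  assumes "smooth \<psi>"
  shows "grad (\<lambda>y. c * \<psi> y) x = c *\<^sub>R grad \<psi> x"
proof -
  have "((\<lambda>y. c * \<psi> y) has_derivative (\<lambda>v. c * frechet_derivative \<psi> (at x) v)) (at x)"
    by (intro has_derivative_mult_right smooth_has_derivative assms)
  then have "frechet_derivative (\<lambda>y. c * \<psi> y) (at x) = (\<lambda>v. c * frechet_derivative \<psi> (at x) v)"
    by (rule frechet_derivative_at[symmetric])
  then show ?thesis by (simp add: grad_def scaleR_sum_right)
qed

text \<open>Testing with \<theta>(t) \<psi>(x) and moving both space derivatives to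
  \<open>\<psi>\<close> removes the weak gradient \<open>G\<close>, so that only the values of
  \<open>u\<close> remain. This replaces differentiating \<integral> u \<psi> in time.\<close>

lemma weak_solution_upto_test_product:
  fixes u :: "real \<Rightarrow> 'a::euclidean_space \<Rightarrow> real"
  assumes ws: "weak_solution_upto T m V u0 u" and m: "m \<ge> 0"
    and \<psi>: "smooth \<psi>" "compact (supp \<psi>)"
    and \<theta>: "smooth \<theta>" "compact (supp \<theta>)" "supp \<theta> \<subseteq> {..<T}"
    and \<theta>': "\<And>t. (\<theta> has_real_derivative \<theta>' t) (at t)" "continuous_on UNIV \<theta>'"
  defines "J \<equiv> \<lambda>z. indicator ({0..T} \<times> UNIV) z *
    (u (fst z) (snd z) * \<theta>' (fst z) * \<psi> (snd z) + \<theta> (fst z) *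
      (u (fst z) (snd z) powr m * lap \<psi> (snd z) - u (fst z) (snd z) * (V (snd z) \<bullet> grad \<psi> (snd z))))"
  shows "integrable lebesgue J"
    and "integral\<^sup>L lebesgue J = - \<theta> 0 * (LINT x|lebesgue. u0 x * \<psi> x)"
proof -
  define S where "S = {0..T} \<times> (UNIV :: 'a set)"
  define U where "U z = u (fst z) (snd z)" for z
  define \<phi> where "\<phi> = (\<lambda>z. \<theta> (fst z) * \<psi> (snd z))"
  have S[measurable]: "S \<in> sets lebesgue" unfolding S_def
    by (intro borel_closed sets_completionI_sets[OF _ ] closed_Times; simp add: closed_Times)
  obtain C where C: "AE z in lebesgue. fst z \<in> {0..T} \<longrightarrow> \<bar>U z\<bar> \<le> C"
    using ws by (auto simp: weak_solution_upto_def case_prod_unfold U_def)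
  have U_ge: "AE z in lebesgue. fst z \<in> {0..T} \<longrightarrow> 0 \<le> U z"
    using ws by (auto simp: weak_solution_upto_def case_prod_unfold U_def)
  have U_meas: "(\<lambda>z. indicator S z * U z) \<in> borel_measurable lebesgue"
    using ws by (auto simp: weak_solution_upto_def case_prod_unfold U_def S_def set_borel_measurable_def)
  have UV: "in_Lp 2 S (\<lambda>z. U z *\<^sub>R V (snd z))"
    using ws by (auto simp: weak_solution_upto_def case_prod_unfold U_def S_def)
  obtain G where G0: "in_Lp 2 ({0..T} \<times> UNIV) (\<lambda>(t, x). G t x)"
    and wg: "AE t in lebesgue. t \<in> {0..T} \<longrightarrow> has_weak_grad (\<lambda>x. u t x powr m) (G t)"
    and test0: "\<forall>\<phi> :: real \<times> 'a \<Rightarrow> real.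
           smooth \<phi> \<and> compact (supp \<phi>) \<and> supp \<phi> \<subseteq> {..<T} \<times> UNIV \<longrightarrow>
           (LINT (t, x):{0..T} \<times> UNIV|lebesgue. u t x * deriv (\<lambda>s. \<phi> (s, x)) t)
           = - (LINT x|lebesgue. u0 x * \<phi> (0, x))
             + (LINT (t, x):{0..T} \<times> UNIV|lebesgue.
                  (G t x + u t x *\<^sub>R V x) \<bullet> grad (\<lambda>y. \<phi> (t, y)) x)"
    using ws unfolding weak_solution_upto_def
    by (elim conjE exE) (rule that, assumption, assumption, assumption)
  have G: "in_Lp 2 S (\<lambda>z. G (fst z) (snd z))"
    using G0 by (simp add: S_def case_prod_unfold)
  have test: "(LINT z|lebesgue. indicator S z * (U z * deriv (\<lambda>s. \<phi> (s, snd z)) (fst z)))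
           = - (LINT x|lebesgue. u0 x * \<phi> (0, x))
             + (LINT z|lebesgue. indicator S z *
                  ((G (fst z) (snd z) + U z *\<^sub>R V (snd z)) \<bullet> grad (\<lambda>y. \<phi> (fst z, y)) (snd z)))"
    if "smooth \<phi>" "compact (supp \<phi>)" "supp \<phi> \<subseteq> {..<T} \<times> UNIV" for \<phi> :: "real \<times> 'a \<Rightarrow> real"
    using test0[rule_format, OF conjI[OF that(1) conjI[OF that(2,3)]]]
    by (simp only: set_lebesgue_integral_def case_prod_unfold S_def U_def real_scaleR_def)
  have \<phi>: "smooth \<phi>" unfolding \<phi>_def
    by (intro smooth_mult smooth_compose_bounded_linear[OF \<psi>(1) bounded_linear_snd]
        smooth_compose_bounded_linear[OF \<theta>(1) bounded_linear_fst])
  have \<phi>_supp: "compact (supp \<phi>)" "supp \<phi> \<subseteq> {..<T} \<times> UNIV"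
    using supp_product[OF \<theta>(2) \<psi>(2)] \<theta>(3) by (auto simp: \<phi>_def)
  have deriv: "deriv (\<lambda>s. \<phi> (s, x)) t = \<theta>' t * \<psi> x" for t x
    unfolding \<phi>_def by (intro DERIV_imp_deriv) (auto intro!: derivative_eq_intros \<theta>')
  have grad: "grad (\<lambda>y. \<phi> (t, y)) x = \<theta> t *\<^sub>R grad \<psi> x" for t x
    unfolding \<phi>_def by (simp add: grad_cmult[OF \<psi>(1)])
  define K where "K = supp \<theta> \<times> supp \<psi>"
  have K: "compact K" unfolding K_def using \<theta>(2) \<psi>(2) by (rule compact_Times)
  have \<theta>'0: "\<theta>' t = 0" if "t \<notin> supp \<theta>" for t
  proof -
    have "(\<theta> has_real_derivative 0) (at t)"
      by (rule has_field_derivative_transform_within_open[OF DERIV_const, where S="- supp \<theta>"])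
        (use that in \<open>simp_all add: notin_supp open_supp_complement\<close>)
    then show ?thesis using \<theta>'(1) DERIV_unique by blast
  qed
  have c1: "continuous_on UNIV (\<lambda>z. \<theta>' (fst z) * \<psi> (snd z))"
    by (intro continuous_intros continuous_on_compose2[OF \<theta>'(2)] continuous_on_compose2[OF smooth_continuous_on[OF \<psi>(1)]]) auto
  have c2: "continuous_on UNIV (\<lambda>z. \<theta> (fst z) * lap \<psi> (snd z))"
    by (intro continuous_intros continuous_on_compose2[OF smooth_continuous_on[OF \<theta>(1)]] continuous_on_compose2[OF smooth_lap_continuous[OF \<psi>(1)]]) auto
  have c3: "continuous_on UNIV (\<lambda>z. \<theta> (fst z) *\<^sub>R grad \<psi> (snd z))"
    by (intro continuous_intros continuous_on_compose2[OF smooth_continuous_on[OF \<theta>(1)]] continuous_on_compose2[OF smooth_grad_continuous[OF \<psi>(1)]]) auto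
  have z1: "\<theta>' (fst z) * \<psi> (snd z) = 0" and z2: "\<theta> (fst z) * lap \<psi> (snd z) = 0"
    and z3: "\<theta> (fst z) *\<^sub>R grad \<psi> (snd z) = 0" if "z \<notin> K" for z
    using that notin_supp[of "fst z" \<theta>] notin_supp[of "snd z" \<psi>] \<theta>'0[of "fst z"]
      lap_notin_supp[of "snd z" \<psi>] grad_notin_supp[of "snd z" \<psi>] by (auto simp: K_def mem_Times_iff)
  have i1: "integrable lebesgue (\<lambda>z. indicator S z * (U z * (\<theta>' (fst z) * \<psi> (snd z))))"
    by (rule bounded_mult_integrable[OF U_meas _ c1 K z1]) (use C in \<open>auto simp: S_def mem_Times_iff\<close>)
  \<comment> \<open>Measurability of \<open>U\<close> is known only on the slab, so the indicator
    has to move inside the power.\<close>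
  have Um_eq: "(\<lambda>z. indicator S z * U z powr m) = (\<lambda>z. indicator S z * (indicator S z * U z) powr m)"
    by (auto simp: indicator_def)
  have i2: "integrable lebesgue (\<lambda>z. indicator S z * (U z powr m * (\<theta> (fst z) * lap \<psi> (snd z))))"
  proof (rule bounded_mult_integrable[OF _ _ c2 K z2])
    show "(\<lambda>z. indicator S z * U z powr m) \<in> borel_measurable lebesgue"
      unfolding Um_eq using U_meas by measurable
    show "AE z in lebesgue. z \<in> S \<longrightarrow> \<bar>U z powr m\<bar> \<le> C powr m"
      using C U_ge by eventually_elim (auto simp: S_def mem_Times_iff intro: powr_mono2 m)
  qed
  have i3: "integrable lebesgue (\<lambda>z. indicator S z * (G (fst z) (snd z) \<bullet> (\<theta> (fst z) *\<^sub>R grad \<psi> (snd z))))"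
    by (rule in_Lp_2_inner_integrable[OF G c3 K z3])
  have i4: "integrable lebesgue (\<lambda>z. indicator S z * ((U z *\<^sub>R V (snd z)) \<bullet> (\<theta> (fst z) *\<^sub>R grad \<psi> (snd z))))"
    by (rule in_Lp_2_inner_integrable[OF UV c3 K z3])
  \<comment> \<open>The weak gradient lives on time slices and exists for almost every
    \<open>t\<close> only, so the identity is proved slice by slice and reassembled by
    Fubini.\<close>
  have G_lap: "(LINT z|lebesgue. indicator S z * (G (fst z) (snd z) \<bullet> (\<theta> (fst z) *\<^sub>R grad \<psi> (snd z))))
      = - (LINT z|lebesgue. indicator S z * (U z powr m * (\<theta> (fst z) * lap \<psi> (snd z))))"
  proof -
    have S': "indicator S (t, x) = (indicator {0..T} t :: real)" for t and x :: 'a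
      by (auto simp: S_def indicator_def)
    have "AE t in lebesgue. (LINT x|lebesgue. indicator S (t, x) * (G t x \<bullet> (\<theta> t *\<^sub>R grad \<psi> x)))
        = - (LINT x|lebesgue. indicator S (t, x) * (U (t, x) powr m * (\<theta> t * lap \<psi> x)))"
      using wg
    proof eventually_elim
      case (elim t)
      have "(LINT x|lebesgue. indicator S (t, x) * (G t x \<bullet> (\<theta> t *\<^sub>R grad \<psi> x)))
        = (LINT x|lebesgue. (indicator {0..T} t * \<theta> t) * (G t x \<bullet> grad \<psi> x))"
        by (simp add: S' mult.assoc)
      also have "\<dots> = (indicator {0..T} t * \<theta> t) * (LINT x|lebesgue. G t x \<bullet> grad \<psi> x)"
        by (rule integral_mult_right_zero)
      also have "\<dots> = - ((indicator {0..T} t * \<theta> t) * (LINT x|lebesgue. u t x powr m * lap \<psi> x))"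
        using has_weak_grad_lap[OF _ \<psi>] elim by (cases "t \<in> {0..T}") auto
      also have "(indicator {0..T} t * \<theta> t) * (LINT x|lebesgue. u t x powr m * lap \<psi> x)
        = (LINT x|lebesgue. (indicator {0..T} t * \<theta> t) * (u t x powr m * lap \<psi> x))"
        by (rule integral_mult_right_zero[symmetric])
      also have "\<dots> = (LINT x|lebesgue. indicator S (t, x) * (U (t, x) powr m * (\<theta> t * lap \<psi> x)))"
        by (simp add: S' U_def mult_ac)
      finally show ?case .
    qed
    then have "(LINT t|lebesgue. LINT x|lebesgue. indicator S (t, x) * (G t x \<bullet> (\<theta> t *\<^sub>R grad \<psi> x)))
        = (LINT t|lebesgue. - (LINT x|lebesgue. indicator S (t, x) * (U (t, x) powr m * (\<theta> t * lap \<psi> x))))"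
      using integrable_lebesgue_fst[OF i3] integrable_lebesgue_fst[OF i2]
      by (intro integral_cong_AE borel_measurable_uminus) (auto dest: borel_measurable_integrable)
    then show ?thesis
      using integral_lebesgue_fst[OF i3] integral_lebesgue_fst[OF i2] by simp
  qed
  have J: "J = (\<lambda>z. (indicator S z * (U z * (\<theta>' (fst z) * \<psi> (snd z)))
      + indicator S z * (U z powr m * (\<theta> (fst z) * lap \<psi> (snd z))))
      - indicator S z * ((U z *\<^sub>R V (snd z)) \<bullet> (\<theta> (fst z) *\<^sub>R grad \<psi> (snd z))))"
    by (auto simp: J_def S_def U_def fun_eq_iff algebra_simps)
  show "integrable lebesgue J" unfolding J using i1 i2 i4 by auto
  have "(LINT z|lebesgue. indicator S z * ((G (fst z) (snd z) + U z *\<^sub>R V (snd z)) \<bullet> (\<theta> (fst z) *\<^sub>R grad \<psi> (snd z))))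
    = (LINT z|lebesgue. indicator S z * (G (fst z) (snd z) \<bullet> (\<theta> (fst z) *\<^sub>R grad \<psi> (snd z))))
    + (LINT z|lebesgue. indicator S z * ((U z *\<^sub>R V (snd z)) \<bullet> (\<theta> (fst z) *\<^sub>R grad \<psi> (snd z))))"
    unfolding inner_add_left distrib_left by (rule Bochner_Integration.integral_add[OF i3 i4])
  moreover have "(LINT x|lebesgue. u0 x * \<phi> (0, x)) = \<theta> 0 * (LINT x|lebesgue. u0 x * \<psi> x)"
    by (simp add: \<phi>_def mult.left_commute)
  moreover have "integral\<^sup>L lebesgue J = (LINT z|lebesgue. indicator S z * (U z * (\<theta>' (fst z) * \<psi> (snd z))))
      + (LINT z|lebesgue. indicator S z * (U z powr m * (\<theta> (fst z) * lap \<psi> (snd z))))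
      - (LINT z|lebesgue. indicator S z * ((U z *\<^sub>R V (snd z)) \<bullet> (\<theta> (fst z) *\<^sub>R grad \<psi> (snd z))))"
    unfolding J by (simp only: Bochner_Integration.integral_diff[OF Bochner_Integration.integrable_add[OF i1 i2] i4]
        Bochner_Integration.integral_add[OF i1 i2])
  ultimately show "integral\<^sup>L lebesgue J = - \<theta> 0 * (LINT x|lebesgue. u0 x * \<psi> x)"
    using test[OF \<phi> \<phi>_supp] unfolding deriv grad G_lap by linarith
qed

section \<open>Exponential growth of a weighted mass\<close>

lemma
  fixes f :: "'a::euclidean_space \<Rightarrow> real" and g :: "'b::euclidean_space \<Rightarrow> real"
  assumes f: "integrable lborel f" and g: "integrable lborel g"
  shows integrable_lborel_product: "integrable lborel (\<lambda>z. f (fst z) * g (snd z))"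
    and integral_lborel_product: "(LINT z|lborel. f (fst z) * g (snd z)) = (LINT x|lborel. f x) * (LINT y|lborel. g y)"
proof -
  have [measurable]: "f \<in> borel_measurable borel" "g \<in> borel_measurable borel"
    using f g by auto
  have i: "integrable (lborel \<Otimes>\<^sub>M lborel) (\<lambda>z. f (fst z) * g (snd z))"
  proof (rule lborel_pair.Fubini_integrable)
    show "(\<lambda>z. f (fst z) * g (snd z)) \<in> borel_measurable (lborel \<Otimes>\<^sub>M lborel)" by measurable
    show "integrable lborel (\<lambda>x. LINT y|lborel. norm (f (fst (x, y)) * g (snd (x, y))))"
      using f g by (simp add: abs_mult)
    show "AE x in lborel. integrable lborel (\<lambda>y. f (fst (x, y)) * g (snd (x, y)))"
      using g by (intro AE_I2) simp
  qed
  then show "integrable lborel (\<lambda>z. f (fst z) * g (snd z))" by (simp only: lborel_prod)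
  have "(LINT x|lborel. LINT y|lborel. f x * g y) = (LINT z|(lborel \<Otimes>\<^sub>M lborel). f (fst z) * g (snd z))"
    using lborel_pair.integral_fst'[OF i] by simp
  then show "(LINT z|lborel. f (fst z) * g (snd z)) = (LINT x|lborel. f x) * (LINT y|lborel. g y)"
    by (simp add: lborel_prod)
qed

section \<open>The cutoff in time\<close>

lemma bump_nonneg: "0 \<le> bump z"
  by (simp add: flat_def)

lemma bump_le_1: "bump z \<le> 1"
  by (simp add: flat_def)

lemma bump_has_derivative: "(bump has_real_derivative flat (monom 1 2) z) (at z)"
  using flat_has_derivative[of 1 z] by simp

lemma flat_monom: "0 < z \<Longrightarrow> flat (monom 1 2) z = bump z / z\<^sup>2"
  by (simp add: flat_def poly_monom power_divide)

text \<open>The left side is the derivative of \<open>bump\<close>. With w = 1/z the claim is w^2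
  \<le> exp w, the square of w \<le> exp(w/2).\<close>

lemma bump_le_square: "0 < z \<Longrightarrow> bump z / z\<^sup>2 \<le> 1"
proof -
  assume z: "0 < z"
  define w where "w = 1 / z"
  have "w / 2 \<le> exp (w / 2 - 1)" using exp_ge_add_one_self[of "w / 2 - 1"] by simp
  moreover have "2 \<le> exp (1::real)" using exp_ge_add_one_self[of "1::real"] by simp
  ultimately have "2 * (w / 2) \<le> exp 1 * exp (w / 2 - 1)"
    using z by (intro mult_mono) (auto simp: w_def)
  then have "w \<le> exp (w / 2)" by (simp add: exp_add[symmetric])
  then have "w * w \<le> exp (w / 2) * exp (w / 2)" using z by (intro mult_mono) (auto simp: w_def)
  then have "w * w \<le> exp w" by (simp add: exp_add[symmetric])
  then have "w * w * exp (- w) \<le> 1" by (simp add: exp_minus field_simps)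
  then show ?thesis using z by (simp add: flat_def w_def power2_eq_square)
qed

text \<open>The rate is \<open>c/2\<close> rather than \<open>c\<close>, so that \<open>\<theta>' + c \<theta> \<ge> 0\<close> for the cutoff \<open>\<theta>\<close>, except within distance
\<open>\<surd>(2/c)\<close> of the final time \<open>T\<close>. The factor \<open>bump (t + 1)\<close> only serves to make the support compact.\<close>

definition cutoff :: "real \<Rightarrow> real \<Rightarrow> real \<Rightarrow> real" where
  "cutoff c T t = exp (- (c / 2) * t) * (bump (T - t) * bump (t + 1))"

definition cutoff' :: "real \<Rightarrow> real \<Rightarrow> real \<Rightarrow> real" where
  "cutoff' c T t = - (c / 2) * cutoff c T t
     + exp (- (c / 2) * t) * (bump (T - t) * flat (monom 1 2) (t + 1) - flat (monom 1 2) (T - t) * bump (t + 1))"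

lemma smooth_id: "smooth (\<lambda>t::real. t)"
  using smooth_bounded_linear[OF bounded_linear_ident] .

lemma smooth_affine:
  "smooth (\<lambda>t::real. T - t)" "smooth (\<lambda>t::real. t + T)" "smooth (\<lambda>t::real. T * t)"
proof -
  have "smooth (\<lambda>t::real. T + (-1) * t)" "smooth (\<lambda>t::real. t + T)" "smooth (\<lambda>t::real. T * t)"
    by (rule smooth_add smooth_mult smooth_const smooth_id)+
  then show "smooth (\<lambda>t::real. T - t)" "smooth (\<lambda>t::real. t + T)" "smooth (\<lambda>t::real. T * t)" by auto
qed

lemma smooth_cutoff: "smooth (cutoff c T)"
  unfolding cutoff_def[abs_def]
  by (rule smooth_mult smooth_exp smooth_flat smooth_affine)+

lemma cutoff_has_derivative: "(cutoff c T has_real_derivative cutoff' c T t) (at t)"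
proof -
  have "((\<lambda>t. bump (T - t)) has_real_derivative flat (monom 1 2) (T - t) * (-1)) (at t)"
    by (rule DERIV_chain2[OF bump_has_derivative]) (auto intro!: derivative_eq_intros)
  moreover have "((\<lambda>t. bump (t + 1)) has_real_derivative flat (monom 1 2) (t + 1) * 1) (at t)"
    by (rule DERIV_chain2[OF bump_has_derivative]) (auto intro!: derivative_eq_intros)
  moreover have "((\<lambda>t. exp (- (c / 2) * t)) has_real_derivative - (c / 2) * exp (- (c / 2) * t)) (at t)"
    by (auto intro!: derivative_eq_intros)
  ultimately show ?thesis
    unfolding cutoff_def[abs_def] cutoff'_def
    by - (rule DERIV_cong, rule DERIV_mult, assumption, rule DERIV_mult, assumption, assumption, simp add: algebra_simps)
qed

lemma continuous_cutoff': "continuous_on UNIV (cutoff' c T)"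
proof -
  have "smooth (\<lambda>t. - (c / 2) * cutoff c T t
     + exp (- (c / 2) * t) * (bump (T - t) * flat (monom 1 2) (t + 1) + (-1) * (flat (monom 1 2) (T - t) * bump (t + 1))))"
    by (rule smooth_add smooth_mult smooth_const smooth_cutoff smooth_exp smooth_flat smooth_affine)+
  then show ?thesis unfolding cutoff'_def[abs_def] using smooth_continuous_on by fastforce
qed

lemma supp_cutoff: "supp (cutoff c T) \<subseteq> {-1..T}"
  unfolding supp_def by (rule closure_minimal) (auto simp: cutoff_def flat_def split: if_splits)

lemma compact_supp_cutoff: "compact (supp (cutoff c T))"
proof -
  have "bounded (supp (cutoff c T))"
    by (rule bounded_subset[OF bounded_closed_interval supp_cutoff])
  moreover have "closed (supp (cutoff c T))" by (simp add: supp_def)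
  ultimately show ?thesis by (simp add: compact_eq_bounded_closed)
qed

lemma cutoff_nonneg: "0 \<le> cutoff c T t"
  by (simp add: cutoff_def bump_nonneg)

lemma cutoff_le_exp: "cutoff c T t \<le> exp (- (c / 2) * t)"
proof -
  have "bump (T - t) * bump (t + 1) \<le> 1 * 1"
    by (intro mult_mono bump_le_1) (auto simp: bump_nonneg)
  then show ?thesis by (simp add: cutoff_def)
qed

text \<open>For t < T the right side is \<theta> (c/2 + 1/(t+1)^2 - 1/(T-t)^2) with \<theta> =
  \<open>cutoff c T t\<close>. The negative term is at most c/2 while T - t > L. Closer to T the
  derivative bound on \<open>bump\<close> leaves only the exponential, which becomes small as T
  grows.\<close>

lemma cutoff_growth:
  assumes c: "c > 0" and t: "0 \<le> t"
  defines "L \<equiv> sqrt (2 / c)"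
  shows "- (indicator {T - L..T} t * exp (- (c / 2) * (T - L))) \<le> cutoff' c T t + c * cutoff c T t"
proof (cases "t < T")
  case False
  then have "cutoff c T t = 0" "cutoff' c T t = 0"
    by (auto simp: cutoff_def cutoff'_def flat_def)
  then show ?thesis by simp
next
  case True
  have eq: "cutoff' c T t + c * cutoff c T t = cutoff c T t * (c / 2) + cutoff c T t / (t + 1)\<^sup>2 - cutoff c T t / (T - t)\<^sup>2"
    using True t by (simp add: cutoff'_def cutoff_def flat_monom algebra_simps diff_divide_distrib)
  have pos: "0 \<le> cutoff c T t / (t + 1)\<^sup>2" "0 \<le> cutoff c T t * (c / 2)"
    using cutoff_nonneg c by auto
  show ?thesis
  proof (cases "t < T - L")
    case far: True
    have "L > 0" "L\<^sup>2 = 2 / c" using c by (auto simp: L_def)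
    have "L\<^sup>2 \<le> (T - t)\<^sup>2" using far \<open>L > 0\<close> by (intro power_mono) auto
    then have "1 / (T - t)\<^sup>2 \<le> c / 2" using \<open>L\<^sup>2 = 2 / c\<close> \<open>L > 0\<close> c True
      by (simp add: field_simps)
    then have "cutoff c T t * (1 / (T - t)\<^sup>2) \<le> cutoff c T t * (c / 2)"
      by (rule mult_left_mono) (rule cutoff_nonneg)
    then show ?thesis using eq pos far by (simp add: indicator_def)
  next
    case near: False
    have "cutoff c T t / (T - t)\<^sup>2 = exp (- (c / 2) * t) * ((bump (T - t) / (T - t)\<^sup>2) * bump (t + 1))"
      by (simp add: cutoff_def)
    also have "\<dots> \<le> exp (- (c / 2) * (T - L)) * (1 * 1)"
      using near True c bump_le_square[of "T - t"] bump_le_1[of "t + 1"]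
      by (intro mult_mono) (auto simp: bump_nonneg)
    finally show ?thesis using eq pos near True by (simp add: indicator_def)
  qed
qed

lemma exp_integral_le:
  fixes c :: real assumes "c > 0" "S \<ge> 0"
  shows "integrable lborel (\<lambda>t. indicator {0..S} t * exp (- (c / 2) * t))"
    and "(LINT t|lborel. indicator {0..S} t * exp (- (c / 2) * t)) \<le> 2 / c"
proof -
  have cont: "continuous_on {0..S} (\<lambda>t. exp (- (c / 2) * t))" by (intro continuous_intros)
  show "integrable lborel (\<lambda>t. indicator {0..S} t * exp (- (c / 2) * t))"
    using borel_integrable_compact[OF compact_Icc cont] by simp
  have "(LINT t|lborel. indicator {0..S} t *\<^sub>R exp (- (c / 2) * t)) = - (2 / c) * exp (- (c / 2) * S) - - (2 / c) * exp (- (c / 2) * 0)"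
    using assms by (intro integral_FTC_atLeastAtMost cont)
      (auto intro!: derivative_eq_intros simp: has_real_derivative_iff_has_vector_derivative[symmetric])
  then show "(LINT t|lborel. indicator {0..S} t * exp (- (c / 2) * t)) \<le> 2 / c"
    using assms by simp
qed

text \<open>The upper bound on \<open>u\<close> is given for t > 0 only, whereas the weak
  formulation integrates over a slab that contains t = 0.\<close>

lemma AE_fst_neq_0: "AE z in (lebesgue :: (real \<times> 'a::euclidean_space) measure). fst z \<noteq> 0"
proof -
  have "AE z in (lborel :: (real \<times> 'a) measure). z \<bullet> (1, 0) \<noteq> 0"
    by (rule AE_lborel_inner_neq) (simp add: Basis_prod_def)
  then show ?thesis by (intro AE_completion) (simp add: inner_prod_def)
qed

text \<open>An integrated form of the fact that a bounded y with y' \<ge> c y - e satisfies y(0)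
  \<le> e/c; the factors exp(-2) and 2 are the price of the smooth cutoff in time. Quantifying
  \<open>key\<close> over every value \<open>w\<close> in [0, M] makes it a pointwise inequality
  that does not mention the solution.\<close>

lemma weak_solution_growth_estimate:
  fixes u :: "real \<Rightarrow> 'a::euclidean_space \<Rightarrow> real"
  assumes ws: "weak_solution m V u0 u" and m: "m \<ge> 0"
    and u_le: "AE z in lebesgue. 0 < fst z \<longrightarrow> u (fst z) (snd z) \<le> M"
    and u0: "\<And>x. 0 \<le> u0 x"
    and \<psi>: "smooth \<psi>" "compact (supp \<psi>)" "\<And>x. 0 \<le> \<psi> x"
    and E: "integrable lborel E" "\<And>x. 0 \<le> E x" and c: "c > 0"
    and key: "AE x in lebesgue. \<forall>w. 0 \<le> w \<and> w \<le> M \<longrightarrow>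
      c * w * \<psi> x - E x \<le> w powr m * lap \<psi> x - w * (V x \<bullet> grad \<psi> x)"
  shows "exp (- 2) * (LINT x|lebesgue. u0 x * \<psi> x) \<le> 2 / c * (LINT x|lborel. E x)"
proof -
  define y0 where "y0 = (LINT x|lebesgue. u0 x * \<psi> x)"
  define L where "L = sqrt (2 / c)"
  define \<kappa> where "\<kappa> T = exp (- (c / 2) * (T - L))" for T
  have y0: "y0 \<ge> 0" unfolding y0_def using u0 \<psi>(3) by (intro integral_nonneg_AE) auto
  have L: "L \<ge> 0" using c by (simp add: L_def)
  have psi_int: "integrable lborel \<psi>"
  proof -
    have "integrable lebesgue \<psi>"
      by (rule integrable_continuous_compact_support[OF smooth_continuous_on[OF \<psi>(1)] \<psi>(2)]) (rule notin_supp)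
    moreover have "\<psi> \<in> borel_measurable borel"
      using smooth_continuous_on[OF \<psi>(1)] by (rule borel_measurable_continuous_onI)
    ultimately show ?thesis by (simp add: integrable_completion)
  qed
  have main: "exp (- 2) * y0 \<le> \<bar>M\<bar> * \<kappa> T * L * (LINT x|lborel. \<psi> x) + 2 / c * (LINT x|lborel. E x)" if T: "T \<ge> 1" for T
  proof -
    define \<theta> where "\<theta> = cutoff c T"
    define \<theta>' where "\<theta>' = cutoff' c T"
    define J where "J = (\<lambda>z. indicator ({0..T+1} \<times> UNIV) z *
      (u (fst z) (snd z) * \<theta>' (fst z) * \<psi> (snd z) + \<theta> (fst z) *
      (u (fst z) (snd z) powr m * lap \<psi> (snd z) - u (fst z) (snd z) * (V (snd z) \<bullet> grad \<psi> (snd z)))))"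
    \<comment> \<open>A bound for -\<open>J\<close>: the first summand covers the strip near the
      final time where \<theta>' + c \<theta> may be negative, the second covers the error
      \<open>E\<close>.\<close>
    define H where "H = (\<lambda>z. (\<bar>M\<bar> * \<kappa> T) * (indicator {T-L..T} (fst z) * \<psi> (snd z))
        + (indicator {0..T+1} (fst z) * exp (- (c / 2) * fst z)) * E (snd z))"
    \<comment> \<open>The support of the cutoff may reach up to \<open>T\<close>, and test functions
      must be supported strictly before the horizon, hence \<open>T+1\<close>.\<close>
    have wsT: "weak_solution_upto (T+1) m V u0 u" using ws T by (simp add: weak_solution_def)
    have sub: "supp \<theta> \<subseteq> {..<T+1}" using supp_cutoff[of c T] by (force simp: \<theta>_def)
    have J: "integrable lebesgue J" "integral\<^sup>L lebesgue J = - \<theta> 0 * y0"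
      unfolding J_def y0_def \<theta>_def \<theta>'_def
      by (rule weak_solution_upto_test_product[OF wsT m \<psi>(1,2) smooth_cutoff compact_supp_cutoff
          sub[unfolded \<theta>_def] cutoff_has_derivative continuous_cutoff'])+
    have ind: "integrable lborel (\<lambda>t. indicator {T-L..T} t :: real)" "(LINT t|lborel. indicator {T-L..T} t :: real) = L"
      using L by (auto simp: integrable_indicator_iff)
    note ex = exp_integral_le[OF c, of "T + 1"]
    note p1 = integrable_lborel_product[OF ind(1) psi_int] integral_lborel_product[OF ind(1) psi_int]
    have T1: "0 \<le> T + 1" using T by simp
    note p2 = integrable_lborel_product[OF ex(1)[OF T1] E(1)] integral_lborel_product[OF ex(1)[OF T1] E(1)]
    have H: "integrable lborel H" unfolding H_def by (intro Bochner_Integration.integrable_add integrable_mult_right p1 p2)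
    have "integral\<^sup>L lborel H = \<bar>M\<bar> * \<kappa> T * (L * (LINT x|lborel. \<psi> x))
        + (LINT t|lborel. indicator {0..T+1} t * exp (- (c / 2) * t)) * (LINT x|lborel. E x)"
      unfolding H_def
      by (subst Bochner_Integration.integral_add) (simp_all only: integrable_mult_right p1 p2 integral_mult_right_zero ind)
    also have "\<dots> \<le> \<bar>M\<bar> * \<kappa> T * (L * (LINT x|lborel. \<psi> x)) + 2 / c * (LINT x|lborel. E x)"
      using ex(2)[OF T1] E(2) by (intro add_left_mono mult_right_mono integral_nonneg_AE) auto
    finally have H_le: "integral\<^sup>L lborel H \<le> \<bar>M\<bar> * \<kappa> T * L * (LINT x|lborel. \<psi> x) + 2 / c * (LINT x|lborel. E x)"
      by (simp add: mult.assoc)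
    have u_ge: "AE z in lebesgue. fst z \<in> {0..T+1} \<longrightarrow> 0 \<le> u (fst z) (snd z)"
      using wsT by (auto simp: weak_solution_upto_def case_prod_unfold)
    have "AE z in lebesgue. - H z \<le> J z"
      using u_ge u_le AE_lebesgue_snd[OF key] AE_fst_neq_0
    proof eventually_elim
      case (elim z)
      obtain t x where z: "z = (t, x)" by (cases z)
      show ?case
      proof (cases "t \<in> {0..T+1}")
        case False
        have "0 \<le> H z" using \<psi>(3) E(2) by (simp add: H_def \<kappa>_def)
        then show ?thesis using False z by (simp add: J_def)
      next
        case True
        define w where "w = u t x"
        have w: "0 \<le> w" "w \<le> M" "0 \<le> t" using elim True z by (auto simp: w_def)
        have th: "0 \<le> \<theta> t" "\<theta> t \<le> exp (- (c / 2) * t)" unfolding \<theta>_def by (rule cutoff_nonneg cutoff_le_exp)+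
        have gr: "- (indicator {T-L..T} t * \<kappa> T) \<le> \<theta>' t + c * \<theta> t"
          using cutoff_growth[OF c w(3), of T] by (simp add: \<theta>_def \<theta>'_def \<kappa>_def L_def)
        have k: "c * w * \<psi> x - E x \<le> w powr m * lap \<psi> x - w * (V x \<bullet> grad \<psi> x)"
          using elim(3) w z by auto
        have "w * \<psi> x * - (indicator {T-L..T} t * \<kappa> T) \<le> w * \<psi> x * (\<theta>' t + c * \<theta> t)"
          by (rule mult_left_mono[OF gr]) (use w \<psi>(3) in auto)
        moreover have "(w * \<psi> x) * (indicator {T-L..T} t * \<kappa> T) \<le> (\<bar>M\<bar> * \<psi> x) * (indicator {T-L..T} t * \<kappa> T)"
          by (intro mult_right_mono) (use w \<psi>(3) in \<open>auto simp: \<kappa>_def\<close>)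
        moreover have "\<theta> t * E x \<le> exp (- (c / 2) * t) * E x" by (rule mult_right_mono[OF th(2) E(2)])
        moreover have "\<theta> t * (c * w * \<psi> x - E x) \<le> \<theta> t * (w powr m * lap \<psi> x - w * (V x \<bullet> grad \<psi> x))"
          by (rule mult_left_mono[OF k th(1)])
        ultimately have "- ((\<bar>M\<bar> * \<kappa> T) * (indicator {T-L..T} t * \<psi> x) + exp (- (c / 2) * t) * E x)
            \<le> w * \<theta>' t * \<psi> x + \<theta> t * (w powr m * lap \<psi> x - w * (V x \<bullet> grad \<psi> x))"
          by (simp add: algebra_simps)
        then show ?thesis using True z by (simp add: H_def J_def w_def)
      qed
    qed
    then have "integral\<^sup>L lebesgue (\<lambda>z. - H z) \<le> integral\<^sup>L lebesgue J"
      using H J(1) by (intro integral_mono_AE) (auto simp: integrable_completion)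
    then have "- integral\<^sup>L lborel H \<le> - \<theta> 0 * y0"
      using H J(2) by (simp add: integral_completion)
    \<comment> \<open>At time 0 the cutoff equals exp(-1/T) exp(-1), and
      \<open>T \<ge> 1\<close>.\<close>
    moreover have "exp (- 2) * y0 \<le> \<theta> 0 * y0"
    proof (rule mult_right_mono[OF _ y0])
      have "exp (-2) = exp (-1) * exp (-1 :: real)" by (simp add: exp_add[symmetric])
      also have "\<dots> \<le> exp (- (1 / T)) * exp (- 1)" using T by (intro mult_right_mono) auto
      also have "\<dots> = \<theta> 0" using T by (simp add: \<theta>_def cutoff_def flat_def)
      finally show "exp (- 2) \<le> \<theta> 0" .
    qed
    ultimately show ?thesis using H_le by linarith
  qed
  \<comment> \<open>As T tends to infinity the strip keeps its length \<open>L\<close> while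
    \<open>\<kappa>\<close> decays exponentially, so the a priori bound \<open>M\<close> disappears
    from the estimate.\<close>
  have "(\<lambda>n. \<bar>M\<bar> * \<kappa> (real n) * L * (LINT x|lborel. \<psi> x) + 2 / c * (LINT x|lborel. E x))
      \<longlonglongrightarrow> \<bar>M\<bar> * 0 * L * (LINT x|lborel. \<psi> x) + 2 / c * (LINT x|lborel. E x)"
  proof (intro tendsto_intros)
    have "\<kappa> (real n) = exp (c / 2 * L) * exp (- (c / 2)) ^ n" for n
    proof -
      have "- (c / 2) * (real n - L) = c / 2 * L + real n * - (c / 2)" by (simp add: field_simps)
      then show ?thesis unfolding \<kappa>_def by (simp only: exp_add exp_of_nat_mult)
    qed
    moreover have "(\<lambda>n. exp (c / 2 * L) * exp (- (c / 2)) ^ n) \<longlonglongrightarrow> 0"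
      using c by (intro tendsto_mult_right_zero LIMSEQ_power_zero) simp
    ultimately show "(\<lambda>n. \<kappa> (real n)) \<longlonglongrightarrow> 0" by simp
  qed
  then have "exp (- 2) * y0 \<le> \<bar>M\<bar> * 0 * L * (LINT x|lborel. \<psi> x) + 2 / c * (LINT x|lborel. E x)"
    by (rule LIMSEQ_le_const) (use main in \<open>auto intro!: exI[of _ 1]\<close>)
  then show ?thesis by (simp add: y0_def)
qed

section \<open>Radial integrals\<close>

definition sphere_area :: "'a::euclidean_space itself \<Rightarrow> real" where
  "sphere_area _ = real DIM('a) * unit_ball_vol (real DIM('a))"

lemma sphere_area_nonneg: "0 \<le> sphere_area TYPE('a::euclidean_space)"
  by (simp add: sphere_area_def)

text \<open>Both measures give the half-line up to a \<ge> 0 the volume of the ball of radius a, and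
  the half-lines form a generating family stable under intersection.\<close>

lemma distr_norm_lborel:
  "distr (lborel :: 'a::euclidean_space measure) borel norm =
     density lborel (\<lambda>r. ennreal (indicator {0..} r * (sphere_area TYPE('a) * r ^ (DIM('a) - 1))))"
    (is "?L = ?D")
proof -
  define v where "v = unit_ball_vol (real DIM('a))"
  have v: "v \<ge> 0" by (simp add: v_def)
  have L: "emeasure ?L {..a} = (if a < 0 then 0 else ennreal (v * a ^ DIM('a)))" for a
  proof -
    have "emeasure ?L {..a} = emeasure lborel (norm -` {..a} \<inter> space (lborel :: 'a measure))"
      by (rule emeasure_distr) auto
    also have "norm -` {..a} \<inter> space (lborel :: 'a measure) = (if a < 0 then {} else cball 0 a)"
      by (cases "a < 0") (auto dest: order_trans[OF norm_ge_zero])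
    finally show ?thesis by (simp add: emeasure_cball v_def)
  qed
  have D: "emeasure ?D {..a} = (if a < 0 then 0 else ennreal (v * a ^ DIM('a)))" for a
  proof (cases "a < 0")
    case True
    have "emeasure ?D {..a} = (\<integral>\<^sup>+r. ennreal (indicator {0..} r * (sphere_area TYPE('a) * r ^ (DIM('a) - 1))) * indicator {..a} r \<partial>lborel)"
      by (rule emeasure_density) auto
    also have "\<dots> = (\<integral>\<^sup>+r. 0 \<partial>(lborel :: real measure))"
      by (intro nn_integral_cong) (use True in \<open>auto simp: indicator_def\<close>)
    finally show ?thesis using True by simp
  next
    case False
    have "emeasure ?D {..a} = (\<integral>\<^sup>+r. ennreal (indicator {0..} r * (sphere_area TYPE('a) * r ^ (DIM('a) - 1))) * indicator {..a} r \<partial>lborel)"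
      by (rule emeasure_density) auto
    also have "\<dots> = (\<integral>\<^sup>+r. ennreal (sphere_area TYPE('a) * r ^ (DIM('a) - 1)) * indicator {0..a} r \<partial>lborel)"
      by (intro nn_integral_cong) (auto simp: indicator_def)
    also have "\<dots> = ennreal (v * a ^ DIM('a) - v * 0 ^ DIM('a))"
      using False
      by (intro nn_integral_FTC_Icc)
        (auto intro!: derivative_eq_intros simp: sphere_area_def v_def)
    finally show ?thesis using False by (simp add: zero_power[OF DIM_positive])
  qed
  show ?thesis
  proof (rule measure_eqI_generator_eq[where E="range atMost" and \<Omega>=UNIV and A="\<lambda>n::nat. {..real n}"])
    show "Int_stable (range atMost :: real set set)"
      by (auto simp: Int_stable_def)
    show "sets ?L = sigma_sets UNIV (range atMost)" "sets ?D = sigma_sets UNIV (range atMost)"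
      by (simp_all add: borel_eq_atMost)
    show "(\<Union>n. {..real n}) = UNIV" by (auto intro: real_arch_simple)
    show "emeasure ?L {..real n} \<noteq> \<infinity>" for n by (simp add: L)
    show "\<And>X. X \<in> range atMost \<Longrightarrow> emeasure ?L X = emeasure ?D X" by (auto simp only: L D)
  qed auto
qed

lemma nn_integral_norm:
  assumes [measurable]: "f \<in> borel_measurable borel"
  shows "(\<integral>\<^sup>+x. f (norm x) \<partial>(lborel :: 'a::euclidean_space measure)) =
    (\<integral>\<^sup>+r. ennreal (indicator {0..} r * (sphere_area TYPE('a) * r ^ (DIM('a) - 1))) * f r \<partial>lborel)"
proof -
  have "(\<integral>\<^sup>+x. f (norm x) \<partial>(lborel :: 'a measure)) = (\<integral>\<^sup>+r. f r \<partial>(distr (lborel :: 'a measure) borel norm))"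
    by (rule nn_integral_distr[symmetric]) auto
  also have "\<dots> = (\<integral>\<^sup>+r. ennreal (indicator {0..} r * (sphere_area TYPE('a) * r ^ (DIM('a) - 1))) * f r \<partial>lborel)"
    unfolding distr_norm_lborel by (rule nn_integral_density) auto
  finally show ?thesis .
qed

text \<open>The majorant \<open>g\<close> already contains the Jacobian r^(d-1), so only a
  one-dimensional antiderivative \<open>G\<close> is needed, and \<open>f\<close> itself need not be
  radial. The origin is exempt from \<open>le\<close> so that singular bounds on \<open>f\<close>
  are admissible.\<close>

lemma
  fixes g G :: "real \<Rightarrow> real" and f :: "'a::euclidean_space \<Rightarrow> real"
  assumes f[measurable]: "f \<in> borel_measurable borel" and f0: "\<And>x. 0 \<le> f x"
    and supp: "\<And>x. norm x > \<rho> \<Longrightarrow> f x = 0" and \<rho>: "0 \<le> \<rho>"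
    and le: "\<And>x. norm x \<le> \<rho> \<Longrightarrow> x \<noteq> 0 \<Longrightarrow> f x * norm x ^ (DIM('a) - 1) \<le> g (norm x)"
    and g[measurable]: "g \<in> borel_measurable borel" and g0: "\<And>r. 0 \<le> r \<Longrightarrow> r \<le> \<rho> \<Longrightarrow> 0 \<le> g r"
    and G: "\<And>r. 0 \<le> r \<Longrightarrow> r \<le> \<rho> \<Longrightarrow> (G has_real_derivative g r) (at r)"
  shows radial_integrable: "integrable lborel f"
    and radial_integral_le: "(LINT x|lborel. f x) \<le> sphere_area TYPE('a) * (G \<rho> - G 0)"
proof -
  let ?h = "\<lambda>r. ennreal (indicator {0..\<rho>} r * (g r / r ^ (DIM('a) - 1)))"
  have "G 0 \<le> G \<rho>" using \<rho>
  proof (rule DERIV_nonneg_imp_nondecreasing)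
    fix r assume "0 \<le> r" "r \<le> \<rho>"
    then show "\<exists>y. (G has_real_derivative y) (at r) \<and> 0 \<le> y" using G[of r] g0[of r] by blast
  qed
  then have nn: "0 \<le> sphere_area TYPE('a) * (G \<rho> - G 0)" using sphere_area_nonneg[where 'a='a] by simp
  have "(\<integral>\<^sup>+x. ennreal (f x) \<partial>lborel) \<le> (\<integral>\<^sup>+x. ?h (norm x) \<partial>(lborel :: 'a measure))"
  proof (rule nn_integral_mono_AE, rule eventually_mono[OF AE_lborel_singleton[of 0]])
    fix x :: 'a assume "x \<noteq> 0"
    then show "ennreal (f x) \<le> ?h (norm x)"
      using le[of x] supp[of x]
      by (cases "norm x \<le> \<rho>") (simp_all add: pos_le_divide_eq ennreal_leI)
  qed
  also have "\<dots> = (\<integral>\<^sup>+r. ennreal (indicator {0..} r * (sphere_area TYPE('a) * r ^ (DIM('a) - 1))) * ?h r \<partial>lborel)"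
    by (rule nn_integral_norm) measurable
  also have "\<dots> \<le> (\<integral>\<^sup>+r. ennreal (sphere_area TYPE('a) * g r) * indicator {0..\<rho>} r \<partial>lborel)"
  proof (rule nn_integral_mono)
    fix r
    show "ennreal (indicator {0..} r * (sphere_area TYPE('a) * r ^ (DIM('a) - 1))) * ?h r
      \<le> ennreal (sphere_area TYPE('a) * g r) * indicator {0..\<rho>} r"
    proof (cases "0 \<le> r \<and> r \<le> \<rho>")
      case True
      have "sphere_area TYPE('a) * r ^ (DIM('a) - 1) * (g r / r ^ (DIM('a) - 1)) \<le> sphere_area TYPE('a) * g r"
        using True g0[of r] sphere_area_nonneg[where 'a='a] by (cases "r ^ (DIM('a) - 1) = 0") (auto simp: mult_nonneg_nonneg)
      then show ?thesis using True g0[of r] sphere_area_nonneg[where 'a='a]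
        by (simp add: ennreal_mult[symmetric] ennreal_leI)
    qed (auto simp: indicator_def)
  qed
  also have "\<dots> = ennreal (sphere_area TYPE('a) * G \<rho> - sphere_area TYPE('a) * G 0)"
    using \<rho> g0 sphere_area_nonneg[where 'a='a]
    by (intro nn_integral_FTC_Icc) (auto intro!: derivative_eq_intros G[THEN DERIV_subset])
  finally have le: "(\<integral>\<^sup>+x. ennreal (f x) \<partial>lborel) \<le> ennreal (sphere_area TYPE('a) * (G \<rho> - G 0))"
    by (simp add: right_diff_distrib)
  show i: "integrable lborel f"
    using le f0 by (intro integrableI_bounded) (auto simp: le_less_trans[OF le])
  have "ennreal (LINT x|lborel. f x) = (\<integral>\<^sup>+x. ennreal (f x) \<partial>lborel)"
    using i f0 by (intro nn_integral_eq_integral[symmetric]) auto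
  then show "(LINT x|lborel. f x) \<le> sphere_area TYPE('a) * (G \<rho> - G 0)"
    using le ennreal_le_iff[OF nn] by metis
qed

section \<open>The radial test function\<close>

lemma bump_mono: "z \<le> w \<Longrightarrow> bump z \<le> bump w"
  by (simp add: flat_def frac_le)

locale test_profile =
  fixes a \<epsilon> R :: real
  assumes a: "0 \<le> a" and \<epsilon>: "0 < \<epsilon>" and R: "0 < R"
begin

definition P :: "real \<Rightarrow> real" where
  "P \<sigma> = (\<sigma> + \<epsilon>) powr (- a) * bump (R - \<sigma>)"

definition P' :: "real \<Rightarrow> real" where
  "P' \<sigma> = - a * (\<sigma> + \<epsilon>) powr (- a - 1) * bump (R - \<sigma>) - (\<sigma> + \<epsilon>) powr (- a) * flat (monom 1 2) (R - \<sigma>)"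

definition H :: "real \<Rightarrow> real" where
  "H \<sigma> = integral {\<sigma>..R} P"

definition \<psi> :: "'a::euclidean_space \<Rightarrow> real" where
  "\<psi> x = H (x \<bullet> x)"

lemma P_nonneg: "0 \<le> P \<sigma>"
  by (simp add: P_def bump_nonneg)

lemma P_eq_0: "R \<le> \<sigma> \<Longrightarrow> P \<sigma> = 0"
  by (simp add: P_def flat_def)

lemma P_has_derivative:
  assumes "- \<epsilon> < \<sigma>"
  shows "(P has_real_derivative P' \<sigma>) (at \<sigma>)"
proof -
  have "((\<lambda>s. bump (R - s)) has_real_derivative flat (monom 1 2) (R - \<sigma>) * (-1)) (at \<sigma>)"
    by (rule DERIV_chain2[OF bump_has_derivative]) (auto intro!: derivative_eq_intros)
  moreover have "((\<lambda>s. (s + \<epsilon>) powr (- a)) has_real_derivative (- a) * (\<sigma> + \<epsilon>) powr (- a - 1) * 1) (at \<sigma>)"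
    by (rule DERIV_chain2[where f="\<lambda>z. z powr (- a)"]) (use assms in \<open>auto intro!: derivative_eq_intros has_real_derivative_powr\<close>)
  ultimately show ?thesis
    unfolding P_def[abs_def] P'_def
    by - (rule DERIV_cong, rule DERIV_mult, assumption, assumption, simp)
qed

lemma P_continuous: "S \<subseteq> {-\<epsilon><..} \<Longrightarrow> continuous_on S P"
  using P_has_derivative DERIV_isCont by (meson continuous_at_imp_continuous_on greaterThan_iff subsetD)

lemma P_integrable: "- \<epsilon> < s \<Longrightarrow> P integrable_on {s..t}"
  by (intro integrable_continuous_real P_continuous) auto

lemma P_antimono:
  assumes "- \<epsilon> < \<sigma>" "\<sigma> \<le> \<tau>"
  shows "P \<tau> \<le> P \<sigma>"
  unfolding P_def using assms a
  by (intro mult_mono bump_mono powr_mono2') (auto simp: bump_nonneg)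

lemma H_eq_0: "R \<le> \<sigma> \<Longrightarrow> H \<sigma> = 0"
  unfolding H_def by (cases "R = \<sigma>") auto

text \<open>\<open>H\<close> has its variable in the lower limit, and that variable may lie beyond
  \<open>R\<close>. As \<open>P\<close> vanishes from \<open>R\<close> on, \<open>H\<close> is
  locally a constant minus an integral with variable upper limit.\<close>

lemma H_has_derivative:
  assumes \<sigma>: "- \<epsilon> < \<sigma>"
  shows "(H has_real_derivative - P \<sigma>) (at \<sigma>)"
proof -
  \<comment> \<open>The midpoint of -\<open>\<epsilon>\<close> and \<open>\<sigma>\<close>: it
    leaves room below \<open>\<sigma>\<close> and stays where \<open>P\<close> is
    continuous.\<close>
  define l where "l = (\<sigma> - \<epsilon>) / 2"
  define B where "B = max R \<sigma> + 1"
  have l: "- \<epsilon> < l" "l < \<sigma>" "\<sigma> < B" "R \<le> B" using \<sigma> by (auto simp: l_def B_def)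
  have eq: "integral {l..B} P - integral {l..s} P = H s" if s: "s \<in> {l<..<B}" for s
  proof -
    have "integral {l..s} P + integral {s..B} P = integral {l..B} P"
      using s l by (intro Henstock_Kurzweil_Integration.integral_combine P_integrable) auto
    moreover have "integral {s..B} P = H s"
    proof (cases "s \<le> R")
      case True
      have "integral {R..B} P = integral {R..B} (\<lambda>_. 0)"
        by (intro Henstock_Kurzweil_Integration.integral_cong) (auto simp: P_eq_0)
      moreover have "integral {s..R} P + integral {R..B} P = integral {s..B} P"
        using s l True by (intro Henstock_Kurzweil_Integration.integral_combine P_integrable) auto
      ultimately show ?thesis by (simp add: H_def)
    next
      case False
      have "integral {s..B} P = integral {s..B} (\<lambda>_. 0)"
        using False by (intro Henstock_Kurzweil_Integration.integral_cong) (auto simp: P_eq_0)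
      then show ?thesis using False by (simp add: H_eq_0)
    qed
    ultimately show ?thesis by simp
  qed
  have "((\<lambda>s. integral {l..s} P) has_real_derivative P \<sigma>) (at \<sigma> within {l..B})"
    using l by (intro integral_has_real_derivative P_continuous) auto
  then have "((\<lambda>s. integral {l..s} P) has_real_derivative P \<sigma>) (at \<sigma>)"
    using l by (simp add: at_within_Icc_at)
  then have "((\<lambda>s. integral {l..B} P - integral {l..s} P) has_real_derivative 0 - P \<sigma>) (at \<sigma>)"
    by (intro DERIV_diff DERIV_const)
  then show ?thesis
    using has_field_derivative_transform_within_open[of _ "- P \<sigma>" \<sigma> "{l<..<B}" H] eq l by simp
qed

lemma H_nonneg: "0 \<le> \<sigma> \<Longrightarrow> 0 \<le> H \<sigma>"
  unfolding H_def using \<epsilon> by (intro Henstock_Kurzweil_Integration.integral_nonneg P_integrable P_nonneg) auto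

text \<open>The dissipation is measured by \<open>P\<close>, the growing quantity by
  \<open>H\<close>; this comparison links them. It holds because \<open>P\<close> decreases and the
  interval of integration has length at most \<open>R\<close>.\<close>

lemma H_le_P:
  assumes "0 \<le> \<sigma>"
  shows "H \<sigma> \<le> R * P \<sigma>"
proof (cases "\<sigma> \<le> R")
  case True
  have "H \<sigma> \<le> integral {\<sigma>..R} (\<lambda>_. P \<sigma>)"
    unfolding H_def using assms \<epsilon> by (intro integral_le P_integrable P_antimono) auto
  also have "\<dots> = (R - \<sigma>) * P \<sigma>" using True by simp
  also have "\<dots> \<le> R * P \<sigma>" using assms by (intro mult_right_mono P_nonneg) auto
  finally show ?thesis .
next
  case False
  then show ?thesis using R by (simp add: H_eq_0 P_nonneg)
qed

text \<open>On [R-2, R-1] the cutoff is at least \<open>bump 1 = exp (- 1)\<close>. The bound does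
  not involve \<open>\<epsilon>\<close>, so the initial weighted mass stays away from 0 as the well
  deepens.\<close>

lemma H_ge:
  assumes "0 \<le> \<sigma>" "\<sigma> \<le> R - 2" "\<epsilon> \<le> 1"
  shows "(R + 1) powr (- a) * exp (- 1) \<le> H \<sigma>"
proof -
  have "(R + 1) powr (- a) * exp (- 1) = integral {R-2..R-1} (\<lambda>_. (R + 1) powr (- a) * exp (- 1))"
    by simp
  also have "\<dots> \<le> integral {R-2..R-1} P"
  proof (intro integral_le P_integrable)
    fix \<tau> assume \<tau>: "\<tau> \<in> {R-2..R-1}"
    have "bump 1 \<le> bump (R - \<tau>)" using \<tau> by (intro bump_mono) auto
    then have "exp (- 1) \<le> bump (R - \<tau>)" by (simp add: flat_def)
    moreover have "(R + 1) powr (- a) \<le> (\<tau> + \<epsilon>) powr (- a)"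
      using \<tau> assms a \<epsilon> by (intro powr_mono2') auto
    ultimately show "(R + 1) powr (- a) * exp (- 1) \<le> P \<tau>"
      unfolding P_def by (intro mult_mono) auto
  qed (use assms \<epsilon> in auto)
  also have "\<dots> \<le> H \<sigma>"
    unfolding H_def using assms \<epsilon> by (intro integral_subset_le P_integrable) (auto simp: P_nonneg)
  finally show ?thesis .
qed

text \<open>With \<open>(t + \<epsilon>) powr al \<le> R + 1\<close>, the profile is at most a
  multiple of t^(-d/2). Bounding t^(-(d-1)/2) by its value at \<open>\<sigma>\<close> leaves the
  integrable t^(-1/2). The resulting singularity |x|^(1-d) is integrable, is uniform in
  \<open>\<epsilon>\<close> and \<open>al\<close>, and avoids a separate logarithmic case for d =
  2.\<close>

lemma H_le_powr:
  assumes \<sigma>: "0 < \<sigma>" and al: "0 \<le> al" "al \<le> 1" "a = d / 2 - al" and d: "1 \<le> d" and e: "\<epsilon> \<le> 1"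
  shows "H \<sigma> \<le> 2 * (R + 1) * sqrt R * \<sigma> powr (- (d - 1) / 2)"
proof (cases "\<sigma> \<le> R")
  case True
  define C where "C = (R + 1) * \<sigma> powr (- (d - 1) / 2)"
  have C: "C \<ge> 0" using R by (simp add: C_def)
  have der: "((\<lambda>t. 2 * C * sqrt t) has_vector_derivative C * t powr (- 1 / 2)) (at t within {\<sigma>..R})" if "t \<in> {\<sigma>..R}" for t
  proof -
    have "t > 0" using that \<sigma> by simp
    then have "((\<lambda>t. 2 * C * sqrt t) has_real_derivative 2 * C * (inverse (sqrt t) / 2)) (at t)"
      by (intro DERIV_cmult DERIV_real_sqrt)
    moreover have "t powr (- 1 / 2) = inverse (sqrt t)"
      using \<open>t > 0\<close> by (simp add: powr_minus powr_half_sqrt[symmetric])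
    ultimately show ?thesis
      by (simp add: has_real_derivative_iff_has_vector_derivative has_vector_derivative_at_within)
  qed
  have I: "((\<lambda>t. C * t powr (- 1 / 2)) has_integral (2 * C * sqrt R - 2 * C * sqrt \<sigma>)) {\<sigma>..R}"
    by (rule fundamental_theorem_of_calculus[OF True der])
  have "H \<sigma> \<le> integral {\<sigma>..R} (\<lambda>t. C * t powr (- 1 / 2))"
    unfolding H_def
  proof (intro integral_le P_integrable)
    show "- \<epsilon> < \<sigma>" using \<sigma> \<epsilon> by simp
    show "(\<lambda>t. C * t powr (- 1 / 2)) integrable_on {\<sigma>..R}" using I by (rule has_integral_integrable)
    fix t assume t: "t \<in> {\<sigma>..R}"
    have t0: "0 < t" using t \<sigma> by simp
    have "P t \<le> (t + \<epsilon>) powr (- a)"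
      unfolding P_def using bump_le_1[of "R - t"] by (intro mult_left_le) auto
    also have "\<dots> = (t + \<epsilon>) powr al * (t + \<epsilon>) powr (- (d / 2))"
      by (simp add: al powr_add[symmetric])
    also have "\<dots> \<le> (R + 1) * t powr (- (d / 2))"
    proof (intro mult_mono)
      have "(t + \<epsilon>) powr al \<le> (R + 1) powr al" using t t0 al e \<epsilon> by (intro powr_mono2) auto
      also have "\<dots> \<le> (R + 1) powr 1" using al R by (intro powr_mono) auto
      finally show "(t + \<epsilon>) powr al \<le> R + 1" using R by simp
      show "(t + \<epsilon>) powr (- (d / 2)) \<le> t powr (- (d / 2))"
        using t0 d \<epsilon> by (intro powr_mono2') auto
    qed (use R in auto)
    also have "t powr (- (d / 2)) = t powr (- (d - 1) / 2) * t powr (- 1 / 2)"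
      by (simp add: powr_add[symmetric] field_simps)
    also have "(R + 1) * \<dots> \<le> (R + 1) * (\<sigma> powr (- (d - 1) / 2) * t powr (- 1 / 2))"
      using R t \<sigma> d by (intro mult_left_mono mult_right_mono powr_mono2') auto
    finally show "P t \<le> C * t powr (- 1 / 2)" by (simp add: C_def)
  qed
  also have "\<dots> = 2 * C * sqrt R - 2 * C * sqrt \<sigma>" using I by (rule integral_unique)
  also have "\<dots> \<le> 2 * C * sqrt R" using C \<sigma> by simp
  finally show ?thesis by (simp only: C_def mult_ac)
next
  case False
  then show ?thesis using R by (simp add: H_eq_0)
qed

section \<open>Derivatives of the test function\<close>

lemma smooth_P: "smooth (\<lambda>x::'a::euclidean_space. c * P (x \<bullet> x))"
proof -
  have "smooth (\<lambda>x::'a. x \<bullet> x + \<epsilon>)" by (intro smooth_add smooth_const smooth_inner_self)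
  moreover have "0 < x \<bullet> x + \<epsilon>" for x :: 'a using \<epsilon> inner_ge_zero[of x] by linarith
  ultimately have "smooth (\<lambda>x::'a. (x \<bullet> x + \<epsilon>) powr (- a))" by (rule smooth_powr)
  moreover have "smooth (\<lambda>x::'a. R + (-1) * (x \<bullet> x))"
    by (intro smooth_add smooth_mult smooth_const smooth_inner_self)
  then have "smooth (\<lambda>x::'a. bump (R + (-1) * (x \<bullet> x)))" by (rule smooth_flat)
  ultimately have "smooth (\<lambda>x::'a. c * ((x \<bullet> x + \<epsilon>) powr (- a) * bump (R + (-1) * (x \<bullet> x))))"
    by (rule smooth_mult[OF smooth_const smooth_mult])
  then show ?thesis by (simp add: P_def)
qed

lemma minus_\<epsilon>_less: "- \<epsilon> < x \<bullet> x"
  using \<epsilon> inner_ge_zero[of x] by linarith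

lemma inner_self_has_derivative: "((\<lambda>x. x \<bullet> x) has_derivative (\<lambda>v. 2 * (x \<bullet> v))) (at x)"
  by (auto intro!: derivative_eq_intros simp: inner_commute)

lemma smooth_\<psi>: "smooth (\<psi> :: 'a::euclidean_space \<Rightarrow> real)"
  unfolding \<psi>_def[abs_def]
proof (rule smooth_compose_antiderivative[OF smooth_inner_self])
  show "(H has_real_derivative - P (x \<bullet> x)) (at (x \<bullet> x))" for x :: 'a
    by (rule H_has_derivative[OF minus_\<epsilon>_less])
  show "smooth (\<lambda>x::'a. - P (x \<bullet> x))" using smooth_P[of "-1"] by simp
qed

lemma \<psi>_nonneg: "0 \<le> \<psi> x"
  by (simp add: \<psi>_def H_nonneg)

lemma \<psi>_eq_0: "sqrt R \<le> norm x \<Longrightarrow> \<psi> x = 0"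
  by (simp add: \<psi>_def H_eq_0 dot_square_norm real_le_lsqrt sqrt_le_D)

lemma compact_supp_\<psi>: "compact (supp (\<psi> :: 'a::euclidean_space \<Rightarrow> real))"
proof -
  have "{x::'a. \<psi> x \<noteq> 0} \<subseteq> cball 0 (sqrt R)" using \<psi>_eq_0 by (force simp: not_le)
  then have "bounded {x::'a. \<psi> x \<noteq> 0}" using bounded_cball bounded_subset by blast
  then show ?thesis by (simp add: supp_def compact_closure)
qed

lemma frechet_derivative_\<psi>: "frechet_derivative \<psi> (at x) = (\<lambda>v. - P (x \<bullet> x) * (2 * (x \<bullet> v)))"
proof -
  have "(\<psi> has_derivative (\<lambda>v. - P (x \<bullet> x) * (2 * (x \<bullet> v)))) (at x)"
    unfolding \<psi>_def[abs_def]
    by (rule has_derivative_compose_real[OF H_has_derivative[OF minus_\<epsilon>_less] inner_self_has_derivative])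
  then show ?thesis by (rule frechet_derivative_at[symmetric])
qed

lemma grad_\<psi>: "grad \<psi> x = - (2 * P (x \<bullet> x)) *\<^sub>R x"
proof -
  have "grad \<psi> x = (\<Sum>b\<in>Basis. (- (2 * P (x \<bullet> x))) *\<^sub>R ((x \<bullet> b) *\<^sub>R b))"
    by (simp add: grad_def frechet_derivative_\<psi> mult_ac)
  also have "\<dots> = - (2 * P (x \<bullet> x)) *\<^sub>R x"
    by (simp only: scaleR_sum_right[symmetric] euclidean_representation)
  finally show ?thesis .
qed

text \<open>The Laplacian of H(|x|^2) is 4 \<sigma> H'' + 2 d H' at \<sigma> = |x|^2, with H' =
  -P.\<close>

lemma lap_\<psi>:
  fixes x :: "'a::euclidean_space"
  shows "lap \<psi> x = - (4 * (x \<bullet> x) * P' (x \<bullet> x) + 2 * real DIM('a) * P (x \<bullet> x))"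
proof -
  have "frechet_derivative (\<lambda>y. frechet_derivative \<psi> (at y) b) (at x) b
      = - (4 * (x \<bullet> b)\<^sup>2 * P' (x \<bullet> x) + 2 * P (x \<bullet> x))" if "b \<in> Basis" for b
  proof -
    have "((\<lambda>y. P (y \<bullet> y)) has_derivative (\<lambda>v. P' (x \<bullet> x) * (2 * (x \<bullet> v)))) (at x)"
      by (rule has_derivative_compose_real[OF P_has_derivative[OF minus_\<epsilon>_less] inner_self_has_derivative])
    then have "((\<lambda>y. - P (y \<bullet> y) * (2 * (y \<bullet> b))) has_derivative
        (\<lambda>v. - P (x \<bullet> x) * (2 * (v \<bullet> b)) + - (P' (x \<bullet> x) * (2 * (x \<bullet> v))) * (2 * (x \<bullet> b)))) (at x)"
      by (intro has_derivative_mult has_derivative_minus derivative_intros) auto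
    then have "frechet_derivative (\<lambda>y. - P (y \<bullet> y) * (2 * (y \<bullet> b))) (at x) =
        (\<lambda>v. - P (x \<bullet> x) * (2 * (v \<bullet> b)) + - (P' (x \<bullet> x) * (2 * (x \<bullet> v))) * (2 * (x \<bullet> b)))"
      by (rule frechet_derivative_at[symmetric])
    then show ?thesis using that by (simp add: frechet_derivative_\<psi> power2_eq_square)
  qed
  then have "lap \<psi> x = (\<Sum>b\<in>Basis. - (4 * (x \<bullet> b)\<^sup>2 * P' (x \<bullet> x) + 2 * P (x \<bullet> x)))"
    by (simp add: lap_def)
  also have "\<dots> = - (4 * (\<Sum>b\<in>Basis. (x \<bullet> b)\<^sup>2) * P' (x \<bullet> x) + 2 * real DIM('a) * P (x \<bullet> x))"
    by (simp add: sum_negf sum.distrib sum_subtractf sum_distrib_left sum_distrib_right)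
  also have "(\<Sum>b\<in>Basis. (x \<bullet> b)\<^sup>2) = x \<bullet> x"
    by (simp add: euclidean_inner[of x x] power2_eq_square)
  finally show ?thesis .
qed

text \<open>Since 4 a = 2 d - 4 \<open>al\<close>, the power in \<open>P\<close> contributes the
  last two terms exactly. The first term is the gain from the cutoff: the logarithmic derivative of
  \<open>bump\<close> at R - \<sigma> is 1/(R - \<sigma>)^2, which is at least 1/R^2.\<close>

lemma lap_profile_ge:
  assumes \<sigma>: "0 \<le> \<sigma>" and al: "a = d / 2 - al"
  shows "P \<sigma> / (\<sigma> + \<epsilon>) * (4 * \<sigma> * (\<sigma> + \<epsilon>) / R\<^sup>2 - 4 * al * \<sigma> - 2 * d * \<epsilon>)
    \<le> - (4 * \<sigma> * P' \<sigma> + 2 * d * P \<sigma>)"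
proof -
  define s where "s = \<sigma> + \<epsilon>"
  have s: "s > 0" using \<sigma> \<epsilon> by (simp add: s_def)
  have P_s: "P \<sigma> = s powr (- a) * bump (R - \<sigma>)" by (simp add: P_def s_def)
  have P'_s: "P' \<sigma> = - a * s powr (- a - 1) * bump (R - \<sigma>) - s powr (- a) * flat (monom 1 2) (R - \<sigma>)"
    by (simp add: P'_def s_def)
  have bmp: "bump (R - \<sigma>) / R\<^sup>2 \<le> flat (monom 1 2) (R - \<sigma>)"
  proof (cases "\<sigma> < R")
    case True
    have "(R - \<sigma>)\<^sup>2 \<le> R\<^sup>2" using True \<sigma> by (intro power_mono) auto
    then show ?thesis using True R by (simp add: flat_monom bump_nonneg frac_le)
  qed (simp add: flat_def)
  have "4 * \<sigma> * s powr (- a) * (bump (R - \<sigma>) / R\<^sup>2) \<le> 4 * \<sigma> * s powr (- a) * flat (monom 1 2) (R - \<sigma>)"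
    by (rule mult_left_mono[OF bmp]) (use \<sigma> in auto)
  moreover have "P \<sigma> / s * (4 * \<sigma> * s / R\<^sup>2 - 4 * al * \<sigma> - 2 * d * \<epsilon>)
      = 4 * \<sigma> * s powr (- a) * (bump (R - \<sigma>) / R\<^sup>2)
        + P \<sigma> / s * (- 4 * al * \<sigma> - 2 * d * \<epsilon>)"
    using s R by (simp add: P_s field_simps)
  moreover have "- (4 * \<sigma> * P' \<sigma> + 2 * d * P \<sigma>)
      = 4 * \<sigma> * s powr (- a) * flat (monom 1 2) (R - \<sigma>)
        + P \<sigma> / s * (- 4 * al * \<sigma> - 2 * d * \<epsilon>)"
  proof -
    have "s powr (- a - 1) = s powr (- a) / s" using s by (simp add: powr_diff)
    moreover have "4 * a * \<sigma> / s - 2 * d = (- 4 * al * \<sigma> - 2 * d * \<epsilon>) / s"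
      using s by (simp add: s_def al field_simps)
    then have "s powr (- a) * bump (R - \<sigma>) * (4 * a * \<sigma> / s - 2 * d)
        = s powr (- a) * bump (R - \<sigma>) * ((- 4 * al * \<sigma> - 2 * d * \<epsilon>) / s)" by simp
    ultimately show ?thesis
      by (simp add: P_s P'_s algebra_simps diff_divide_distrib)
  qed
  ultimately show ?thesis by (simp add: s_def)
qed

text \<open>Without the cutoff, the Laplacian of the profile is \<open>- P (4 al \<sigma> + 2 d \<epsilon>) / (\<sigma> + \<epsilon>)\<close>. Half of the
drift \<open>4 b \<sigma> P / (\<sigma> + \<epsilon>)\<close> absorbs its first term by the choice \<open>al = b / (2k)\<close>, the other half absorbs its
second term unless \<open>\<sigma> < d \<epsilon> k / b\<close>.\<close>

lemma weighted_lap_profile_ge: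
  assumes al: "a = d / 2 - al" "al = b / (2 * k)" "4 * al \<le> 1 / R\<^sup>2" and b: "0 < b" and k: "0 < k"
    and d: "0 \<le> d" "4 * d * \<epsilon> \<le> 1 / R\<^sup>2" and e: "\<epsilon> \<le> 1 / 2"
    and m: "1 < m" and w: "0 \<le> w" "w \<le> M" and M: "M powr (m - 1) \<le> k" and \<sigma>: "0 \<le> \<sigma>"
  shows "2 / R\<^sup>2 * \<sigma> * w powr m * P \<sigma> - (if \<sigma> < d * \<epsilon> * k / b then 2 * d * k * M * \<epsilon> powr (- a) else 0)
    \<le> w powr m * - (4 * \<sigma> * P' \<sigma> + 2 * d * P \<sigma>)
      + w * (if \<sigma> + \<epsilon> < 1 then 4 * b * \<sigma> * P \<sigma> / (\<sigma> + \<epsilon>) else 0)"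
    (is "?main - ?err \<le> _ * ?lap + _ * ?drift")
proof -
  define s where "s = \<sigma> + \<epsilon>"
  define Q where "Q = P \<sigma> / s"
  define v where "v = w powr (m - 1)"
  define lam where "lam = 1 / R\<^sup>2"
  define D where "D = (if s < 1 then 4 * b * \<sigma> else 0)"
  have s: "0 < s" "\<epsilon> \<le> s" using \<sigma> \<epsilon> by (auto simp: s_def)
  have Q: "0 \<le> Q" "P \<sigma> = Q * s" using s by (auto simp: Q_def P_nonneg)
  have v: "0 \<le> v" "v \<le> k"
  proof -
    have "v \<le> M powr (m - 1)" unfolding v_def using w m by (intro powr_mono2) auto
    then show "v \<le> k" using M by simp
  qed (simp add: v_def)
  have wm: "w powr m = w * v"
    using w powr_mult_base[of w "m - 1"] by (simp add: v_def)
  have lam: "0 < lam" "4 * al \<le> lam" "4 * d * \<epsilon> \<le> lam" using R al(3) d(2) by (auto simp: lam_def)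
  have al0: "0 \<le> al" "4 * al * k = 2 * b" using b k by (simp_all add: al(2))
  have err0: "0 \<le> ?err" using d k w by simp
  have core: "2 * lam * (v * \<sigma> * s) * (w * Q) - ?err \<le> (w * Q) * (v * (4 * \<sigma> * s * lam - 4 * al * \<sigma> - 2 * d * \<epsilon>) + D)"
  proof (cases "s < 1")
    case True
    have "4 * al * \<sigma> * v \<le> 4 * al * \<sigma> * k" using v al0 \<sigma> by (intro mult_left_mono) auto
    also have "\<dots> = 2 * b * \<sigma>" using al0(2) by (metis mult.assoc mult.commute)
    finally have 1: "v * (4 * al * \<sigma>) \<le> 2 * b * \<sigma>" by (simp add: mult_ac)
    have 2: "v * (2 * d * \<epsilon>) \<le> k * (2 * d * \<epsilon>)" using v d \<epsilon> by (intro mult_right_mono) auto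
    have 3: "0 \<le> lam * (v * \<sigma> * s)" using lam v \<sigma> s by simp
    have br: "2 * lam * (v * \<sigma> * s) + (2 * b * \<sigma> - 2 * d * \<epsilon> * k) \<le> v * (4 * \<sigma> * s * lam - 4 * al * \<sigma> - 2 * d * \<epsilon>) + D"
      using 1 2 3 True by (simp add: D_def algebra_simps)
    have low: "- ?err \<le> (w * Q) * (2 * b * \<sigma> - 2 * d * \<epsilon> * k)"
    proof (cases "\<sigma> < d * \<epsilon> * k / b")
      case False
      then have "d * \<epsilon> * k \<le> b * \<sigma>" using b by (simp add: field_simps)
      then have "0 \<le> (w * Q) * (2 * b * \<sigma> - 2 * d * \<epsilon> * k)" using w Q by (intro mult_nonneg_nonneg) auto
      then show ?thesis using err0 by linarith
    next
      case in_core: True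
      \<comment> \<open>In the core the loss 2 d \<epsilon> k exceeds what the drift supplies. The
        bounds \<epsilon> \<le> s and P \<le> \<open>\<epsilon> powr (- a)\<close> turn it into the
        error term of the statement.\<close>
      have "Q * \<epsilon> \<le> P \<sigma>" using Q s by (simp add: mult_left_mono)
      also have "P \<sigma> \<le> s powr (- a)" unfolding P_def s_def using bump_le_1[of "R - \<sigma>"] by (intro mult_left_le) auto
      also have "\<dots> \<le> \<epsilon> powr (- a)" using s \<epsilon> a by (intro powr_mono2') auto
      finally have "w * (Q * \<epsilon>) \<le> M * \<epsilon> powr (- a)" using w Q \<epsilon> by (intro mult_mono) auto
      then have "(2 * d * k) * (w * (Q * \<epsilon>)) \<le> (2 * d * k) * (M * \<epsilon> powr (- a))"
        using d k by (intro mult_left_mono) auto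
      moreover have "0 \<le> (w * Q) * (2 * b * \<sigma>)" using w Q b \<sigma> by simp
      ultimately show ?thesis using in_core by (simp add: algebra_simps)
    qed
    have "(w * Q) * (2 * lam * (v * \<sigma> * s) + (2 * b * \<sigma> - 2 * d * \<epsilon> * k))
        \<le> (w * Q) * (v * (4 * \<sigma> * s * lam - 4 * al * \<sigma> - 2 * d * \<epsilon>) + D)"
      by (rule mult_left_mono[OF br]) (use w Q in simp)
    then show ?thesis using low by (simp add: distrib_left mult_ac)
  next
    case False
    \<comment> \<open>Outside the well there is no drift. Of the gain 4 \<open>lam\<close> \<sigma>
      s one half is kept; one quarter absorbs 4 \<open>al\<close> \<sigma> and the last one absorbs
      2 d \<epsilon>, both by the smallness assumptions on \<open>al\<close> and
      \<open>\<epsilon>\<close>.\<close>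
    have s1: "1 \<le> s" "1 / 2 \<le> \<sigma>" using False e by (auto simp: s_def)
    have "lam * \<sigma> * 1 \<le> lam * \<sigma> * s" using lam \<sigma> s1 by (intro mult_left_mono) auto
    moreover have "4 * al * \<sigma> \<le> lam * \<sigma>" using lam \<sigma> by (intro mult_right_mono) auto
    moreover have "lam * (1 / 2) \<le> lam * \<sigma>" using lam s1 by (intro mult_left_mono) auto
    ultimately have "2 * lam * (\<sigma> * s) \<le> 4 * \<sigma> * s * lam - 4 * al * \<sigma> - 2 * d * \<epsilon>"
      using lam(3) by (simp add: algebra_simps)
    then have "v * (2 * lam * (\<sigma> * s)) \<le> v * (4 * \<sigma> * s * lam - 4 * al * \<sigma> - 2 * d * \<epsilon>)"
      using v by (intro mult_left_mono) auto
    moreover have "0 \<le> D" using b \<sigma> by (simp add: D_def)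
    ultimately have "(w * Q) * (v * (2 * lam * (\<sigma> * s))) \<le> (w * Q) * (v * (4 * \<sigma> * s * lam - 4 * al * \<sigma> - 2 * d * \<epsilon>) + D)"
      using w Q by (intro mult_left_mono) auto
    then show ?thesis using err0 by (simp add: mult_ac)
  qed
  have "w powr m * (Q * (4 * \<sigma> * s * lam - 4 * al * \<sigma> - 2 * d * \<epsilon>)) \<le> w powr m * ?lap"
    using lap_profile_ge[OF \<sigma> al(1)] by (intro mult_left_mono) (auto simp: Q_def s_def lam_def)
  moreover have "?drift = Q * D" by (simp add: Q_def D_def s_def)
  moreover have "?main = 2 * lam * (v * \<sigma> * s) * (w * Q)"
    by (simp add: wm Q(2) lam_def)
  ultimately have "(w * Q) * (v * (4 * \<sigma> * s * lam - 4 * al * \<sigma> - 2 * d * \<epsilon>) + D) \<le> w powr m * ?lap + w * ?drift"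
    by (simp add: wm distrib_left mult_ac)
  with core \<open>?main = _\<close> show ?thesis by linarith
qed

text \<open>The dissipation is superlinear in \<open>w\<close> and carries a factor
  \<open>\<sigma>\<close>. Replacing w^m by the affine lower bound \<eta>^(m-1) (w - \<eta>), and
  \<open>\<sigma>\<close> by \<open>\<delta>\<close> away from the origin, produces linear growth
  with a rate independent of \<open>a\<close> and \<open>\<epsilon>\<close>. The two subtracted
  terms cover small \<open>w\<close> and small \<open>\<sigma>\<close>.\<close>

lemma dissipation_ge_growth:
  assumes \<delta>: "0 < \<delta>" and \<eta>: "0 < \<eta>" and m: "1 < m" and w: "0 \<le> w" "w \<le> M" and \<sigma>: "0 \<le> \<sigma>"
  defines "c \<equiv> 2 * \<delta> * \<eta> powr (m - 1) / R ^ 3"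
  shows "c * w * H \<sigma> - (c * \<eta> * H \<sigma> + (if \<sigma> < \<delta> then c * M * H \<sigma> else 0)) \<le> 2 / R\<^sup>2 * \<sigma> * w powr m * P \<sigma>"
proof -
  have c: "0 \<le> c" using \<delta> R by (simp add: c_def)
  have H: "0 \<le> H \<sigma>" using \<sigma> by (rule H_nonneg)
  have rhs: "0 \<le> 2 / R\<^sup>2 * \<sigma> * w powr m * P \<sigma>" using \<sigma> by (simp add: P_nonneg)
  show ?thesis
  proof (cases "\<sigma> < \<delta>")
    case True
    have "c * H \<sigma> * w \<le> c * H \<sigma> * M" using c H w by (intro mult_left_mono) auto
    moreover have "0 \<le> c * \<eta> * H \<sigma>" using c H \<eta> by simp
    ultimately have "c * w * H \<sigma> - (c * \<eta> * H \<sigma> + c * M * H \<sigma>) \<le> 0" by (simp add: mult_ac)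
    then show ?thesis using rhs True by (simp only: if_True)
  next
    case False
    have "\<eta> powr (m - 1) * (w - \<eta>) \<le> w powr m"
    proof (cases "\<eta> \<le> w")
      case True
      then have "\<eta> powr (m - 1) \<le> w powr (m - 1)" using \<eta> m by (intro powr_mono2) auto
      then have "\<eta> powr (m - 1) * (w - \<eta>) \<le> w powr (m - 1) * w" using True \<eta> by (intro mult_mono) auto
      then show ?thesis using powr_mult_base[OF w(1), of "m - 1"] by (simp add: mult.commute)
    next
      case F: False
      then have "\<eta> powr (m - 1) * (w - \<eta>) \<le> 0" by (intro mult_nonneg_nonpos) auto
      then show ?thesis using powr_ge_zero[of w m] by linarith
    qed
    then have "(2 * \<delta> / R ^ 3 * H \<sigma>) * (\<eta> powr (m - 1) * (w - \<eta>)) \<le> (2 * \<delta> / R ^ 3 * H \<sigma>) * w powr m"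
      using \<delta> R H by (intro mult_left_mono) auto
    also have "\<dots> \<le> (2 * \<sigma> / R ^ 3 * (R * P \<sigma>)) * w powr m"
      using False \<delta> R H H_le_P[OF \<sigma>] by (intro mult_right_mono mult_mono divide_right_mono) auto
    also have "\<dots> = 2 / R\<^sup>2 * \<sigma> * w powr m * P \<sigma>"
      using R by (simp add: power2_eq_square power3_eq_cube)
    finally show ?thesis using False by (simp add: c_def algebra_simps diff_divide_distrib)
  qed
qed

text \<open>The bound |x|^(1-d) on \<open>\<psi>\<close> cancels the Jacobian, so the mass in a ball
  is at most linear in its radius. The constants depend on \<open>R\<close> and the dimension alone,
  and the mass in |x|^2 < \<open>\<delta>\<close> can be made small uniformly in the well.\<close>

lemma
  assumes al: "0 \<le> al" "al \<le> 1" "a = real DIM('a) / 2 - al" and e: "\<epsilon> \<le> 1"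
  shows \<psi>_integrable: "integrable lborel (\<psi> :: 'a::euclidean_space \<Rightarrow> real)"
    and \<psi>_integral_le: "(LINT x|lborel. \<psi> (x :: 'a)) \<le> sphere_area TYPE('a) * (2 * (R + 1) * sqrt R * sqrt R)"
    and \<psi>_integrable_ball: "0 \<le> \<delta> \<Longrightarrow> integrable lborel (\<lambda>x :: 'a. if x \<bullet> x < \<delta> then \<psi> x else 0)"
    and \<psi>_integral_ball_le: "0 \<le> \<delta> \<Longrightarrow> (LINT x|lborel. (if x \<bullet> (x :: 'a) < \<delta> then \<psi> x else 0))
      \<le> sphere_area TYPE('a) * (2 * (R + 1) * sqrt R * sqrt \<delta>)"
proof -
  define C where "C = 2 * (R + 1) * sqrt R"
  have C: "0 \<le> C" using R by (simp add: C_def)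
  have le: "\<psi> x * norm x ^ (DIM('a) - 1) \<le> C" if "x \<noteq> 0" for x :: 'a
  proof -
    have n: "0 < norm x" "0 < x \<bullet> x" using that by auto
    have d: "1 \<le> real DIM('a)" using DIM_positive[where 'a='a] by linarith
    have "(x \<bullet> x) powr (- (real DIM('a) - 1) / 2) = norm x powr (- (real DIM('a) - 1))"
      using n by (simp add: dot_square_norm powr_powr diff_divide_distrib flip: powr_numeral)
    moreover have "norm x ^ (DIM('a) - 1) = norm x powr (real DIM('a) - 1)"
      using n d by (simp add: powr_realpow[symmetric] of_nat_diff)
    ultimately have one: "(x \<bullet> x) powr (- (real DIM('a) - 1) / 2) * norm x ^ (DIM('a) - 1) = 1"
      using n by (simp add: powr_add[symmetric])
    have "\<psi> x * norm x ^ (DIM('a) - 1) \<le> (C * (x \<bullet> x) powr (- (real DIM('a) - 1) / 2)) * norm x ^ (DIM('a) - 1)"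
      unfolding \<psi>_def C_def using n by (intro mult_right_mono H_le_powr[OF _ al d e]) auto
    then show ?thesis using one by (simp add: mult.assoc)
  qed
  have m[measurable]: "(\<psi> :: 'a \<Rightarrow> real) \<in> borel_measurable borel"
    by (intro borel_measurable_continuous_onI smooth_continuous_on smooth_\<psi>)
  have G: "((\<lambda>r. C * r) has_real_derivative C) (at r)" for r by (auto intro!: derivative_eq_intros)
  have z: "\<psi> x = 0" if "sqrt R < norm x" for x :: 'a using that by (intro \<psi>_eq_0) simp
  have sR: "0 \<le> sqrt R" using R by simp
  have cm: "(\<lambda>r::real. C) \<in> borel_measurable borel" by simp
  show "integrable lborel (\<psi> :: 'a \<Rightarrow> real)"
    by (rule radial_integrable[OF m \<psi>_nonneg z sR le cm C G])
  have "(LINT x|lborel. \<psi> (x :: 'a)) \<le> sphere_area TYPE('a) * (C * sqrt R - C * 0)"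
    by (rule radial_integral_le[OF m \<psi>_nonneg z sR le cm C G])
  then show "(LINT x|lborel. \<psi> (x :: 'a)) \<le> sphere_area TYPE('a) * (2 * (R + 1) * sqrt R * sqrt R)"
    by (simp add: C_def)
  {
    assume \<delta>: "0 \<le> \<delta>"
    let ?f = "\<lambda>x :: 'a. if x \<bullet> x < \<delta> then \<psi> x else 0"
    have fm: "?f \<in> borel_measurable borel" by measurable
    have f0: "0 \<le> ?f x" for x by (simp add: \<psi>_nonneg)
    have fz: "?f x = 0" if "sqrt \<delta> < norm x" for x :: 'a
    proof -
      have "\<delta> < (norm x)\<^sup>2" using that by (metis real_sqrt_less_iff real_sqrt_abs abs_norm_cancel)
      then show ?thesis by (simp add: dot_square_norm)
    qed
    have fle: "?f x * norm x ^ (DIM('a) - 1) \<le> C" if "x \<noteq> 0" for x :: 'a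
      using le[OF that] C by simp
    have s: "0 \<le> sqrt \<delta>" using \<delta> by simp
    show "integrable lborel ?f"
      by (rule radial_integrable[OF fm f0 fz s fle cm C G])
    have "(LINT x|lborel. ?f x) \<le> sphere_area TYPE('a) * (C * sqrt \<delta> - C * 0)"
      by (rule radial_integral_le[OF fm f0 fz s fle cm C G])
    then show "(LINT x|lborel. ?f x) \<le> sphere_area TYPE('a) * (2 * (R + 1) * sqrt R * sqrt \<delta>)"
      by (simp add: C_def)
  }
qed

end

section \<open>The logarithmic well\<close>

definition log_well :: "real \<Rightarrow> real \<Rightarrow> 'a::euclidean_space \<Rightarrow> real" where
  "log_well b \<epsilon> x = b * ln (min 1 (x \<bullet> x + \<epsilon>))"

text \<open>A Borel representative of the gradient. The value 0 on the sphere |x|^2 + \<epsilon> =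
  1, where the well may have a kink, is a convention on a null set.\<close>

definition log_well_grad :: "real \<Rightarrow> real \<Rightarrow> 'a::euclidean_space \<Rightarrow> 'a" where
  "log_well_grad b \<epsilon> x = (if x \<bullet> x + \<epsilon> < 1 then (2 * b / (x \<bullet> x + \<epsilon>)) *\<^sub>R x else 0)"

lemma log_well_lipschitz:
  assumes b: "0 \<le> b" and \<epsilon>: "0 < \<epsilon>" "\<epsilon> \<le> 1"
  shows "(2 * b / \<epsilon>)-lipschitz_on UNIV (log_well b \<epsilon> :: 'a::euclidean_space \<Rightarrow> real)"
proof -
  define q where "q x = min 1 (x \<bullet> x + \<epsilon>)" for x :: 'a
  have q: "\<epsilon> \<le> q x" for x using \<epsilon> by (simp add: q_def)
  \<comment> \<open>Capping the norm at 1 leaves \<open>q\<close> unchanged and keeps the squared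
    quantity in [0, 1], where squaring has Lipschitz constant 2. On values at least
    \<open>\<epsilon>\<close> the logarithm then contributes 1/\<epsilon>.\<close>
  have q_norm: "q x = min 1 ((min 1 (norm x))\<^sup>2 + \<epsilon>)" for x
  proof (cases "1 \<le> norm x")
    case True
    then have "1 \<le> (norm x)\<^sup>2" by (rule one_le_power)
    then have "1 \<le> (norm x)\<^sup>2 + \<epsilon>" using \<epsilon> by linarith
    then show ?thesis using True \<epsilon> by (simp add: q_def dot_square_norm min_absorb1)
  qed (simp add: q_def dot_square_norm)
  have diff: "\<bar>q x - q y\<bar> \<le> 2 * norm (x - y)" for x y
  proof -
    define r s where "r = min 1 (norm x)" and "s = min 1 (norm y)"
    have rs: "\<bar>r - s\<bar> \<le> norm (x - y)" "0 \<le> r + s" "r + s \<le> 2"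
      using norm_triangle_ineq3[of x y] by (auto simp: r_def s_def min_def)
    have "\<bar>q x - q y\<bar> \<le> \<bar>r\<^sup>2 - s\<^sup>2\<bar>"
      unfolding q_norm r_def[symmetric] s_def[symmetric] by (auto simp: min_def)
    also have "\<dots> = \<bar>r - s\<bar> * (r + s)"
      using rs by (simp add: power2_eq_square square_diff_square_factored abs_mult mult.commute)
    also have "\<dots> \<le> norm (x - y) * 2" using rs by (intro mult_mono) auto
    finally show ?thesis by simp
  qed
  have one: "ln (q x) - ln (q y) \<le> 2 * norm (x - y) / \<epsilon>" for x y
  proof -
    have pos: "0 < q x" "0 < q y" using q[of x] q[of y] \<epsilon> by auto
    have "ln (q x) - ln (q y) \<le> (q x - q y) / q y" by (rule ln_diff_le[OF pos])
    also have "\<dots> \<le> \<bar>q x - q y\<bar> / q y" using pos by (intro divide_right_mono) auto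
    also have "\<dots> \<le> 2 * norm (x - y) / \<epsilon>" using diff[of x y] q[of y] \<epsilon> by (intro frac_le) auto
    finally show ?thesis .
  qed
  show ?thesis
  proof (rule lipschitz_onI)
    fix x y :: 'a
    have "\<bar>ln (q x) - ln (q y)\<bar> \<le> 2 * norm (x - y) / \<epsilon>"
      using one[of x y] one[of y x] by (simp add: norm_minus_commute)
    then have "b * \<bar>ln (q x) - ln (q y)\<bar> \<le> b * (2 * norm (x - y) / \<epsilon>)" using b by (rule mult_left_mono)
    then show "dist (log_well b \<epsilon> x) (log_well b \<epsilon> y) \<le> 2 * b / \<epsilon> * dist x y"
      using b by (simp add: log_well_def q_def[symmetric] dist_norm right_diff_distrib[symmetric] abs_mult mult_ac)
  qed (use b \<epsilon> in auto)
qed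

lemma grad_log_well:
  fixes x :: "'a::euclidean_space"
  assumes \<epsilon>: "0 < \<epsilon>" and x: "x \<bullet> x + \<epsilon> \<noteq> 1"
  shows "grad (log_well b \<epsilon>) x = log_well_grad b \<epsilon> x"
proof (cases "x \<bullet> x + \<epsilon> < 1")
  case True
  have s: "0 < x \<bullet> x + \<epsilon>" using \<epsilon> inner_ge_zero[of x] by linarith
  have cont: "continuous_on UNIV (\<lambda>y::'a. y \<bullet> y + \<epsilon>)" by (intro continuous_intros)
  have "((\<lambda>y::'a. b * ln (y \<bullet> y + \<epsilon>)) has_derivative (\<lambda>v. (2 * b / (x \<bullet> x + \<epsilon>)) * (x \<bullet> v))) (at x)"
    using s by (auto intro!: derivative_eq_intros simp: inner_commute field_simps)
  then have "(log_well b \<epsilon> has_derivative (\<lambda>v. (2 * b / (x \<bullet> x + \<epsilon>)) * (x \<bullet> v))) (at x)"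
    by (rule has_derivative_transform_within_open[where s="{y. y \<bullet> y + \<epsilon> < 1}"])
      (use True in \<open>auto simp: log_well_def min_def intro!: open_Collect_less continuous_intros\<close>)
  then have "frechet_derivative (log_well b \<epsilon>) (at x) = (\<lambda>v. (2 * b / (x \<bullet> x + \<epsilon>)) * (x \<bullet> v))"
    by (rule frechet_derivative_at[symmetric])
  then have "grad (log_well b \<epsilon>) x = (\<Sum>c\<in>Basis. (2 * b / (x \<bullet> x + \<epsilon>)) *\<^sub>R ((x \<bullet> c) *\<^sub>R c))"
    by (simp add: grad_def)
  also have "\<dots> = (2 * b / (x \<bullet> x + \<epsilon>)) *\<^sub>R x"
    by (simp only: scaleR_sum_right[symmetric] euclidean_representation)
  finally show ?thesis using True by (simp add: log_well_grad_def)
next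
  case False
  then have "x \<bullet> x + \<epsilon> > 1" using x by simp
  then have "(log_well b \<epsilon> has_derivative (\<lambda>v. 0)) (at x)"
    by (intro has_derivative_transform_within_open[OF has_derivative_const[of 0], where s="{y. 1 < y \<bullet> y + \<epsilon>}"])
      (auto simp: log_well_def min_def intro!: open_Collect_less continuous_intros)
  then have "frechet_derivative (log_well b \<epsilon>) (at x) = (\<lambda>v. 0)"
    by (rule frechet_derivative_at[symmetric])
  then show ?thesis using False by (simp add: grad_def log_well_grad_def)
qed

lemma AE_grad_log_well:
  assumes \<epsilon>: "0 < \<epsilon>" "\<epsilon> < 1"
  shows "AE x in lebesgue. grad (log_well b \<epsilon>) x = log_well_grad b \<epsilon> (x :: 'a::euclidean_space)"
proof (rule AE_I')
  show "sphere (0::'a) (sqrt (1 - \<epsilon>)) \<in> null_sets lebesgue"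
    using negligible_sphere negligible_iff_null_sets by blast
  have "x \<in> sphere 0 (sqrt (1 - \<epsilon>))" if "x \<bullet> x + \<epsilon> = 1" for x :: 'a
    using that by (simp add: norm_eq_sqrt_inner algebra_simps)
  then show "{x \<in> space lebesgue. grad (log_well b \<epsilon>) x \<noteq> log_well_grad b \<epsilon> x} \<subseteq> sphere (0::'a) (sqrt (1 - \<epsilon>))"
    using grad_log_well[OF \<epsilon>(1)] by blast
qed

lemma borel_log_well_grad: "(log_well_grad b \<epsilon> :: 'a::euclidean_space \<Rightarrow> 'a) \<in> borel_measurable borel"
  unfolding log_well_grad_def[abs_def] by measurable

text \<open>The p-th power is at most 1 plus the critical d-th power. For the latter, V \<le> 2 b
  r/s with s = r^2 + \<epsilon> and r^2/s \<le> 1 reduce V^d r^(d-1) to (2 b)^d r/s, which has a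
  logarithm as antiderivative.\<close>

lemma log_well_grad_powr_le:
  fixes x :: "'a::euclidean_space"
  assumes b: "0 \<le> b" and \<epsilon>: "0 < \<epsilon>" and p: "1 \<le> p" "p \<le> real DIM('a)"
  shows "norm (log_well_grad b \<epsilon> x) powr p * norm x ^ (DIM('a) - 1)
    \<le> norm x ^ (DIM('a) - 1) + (2 * b) ^ DIM('a) * (norm x / ((norm x)\<^sup>2 + \<epsilon>))"
proof -
  define V r s n where "V = norm (log_well_grad b \<epsilon> x)" and "r = norm x" and "s = r\<^sup>2 + \<epsilon>" and "n = DIM('a)"
  have s: "0 < s" using \<epsilon> by (simp add: s_def add_nonneg_pos)
  have r: "0 \<le> r" by (simp add: r_def)
  have n: "0 < n" by (simp add: n_def)
  have V: "0 \<le> V" "V \<le> 2 * b * r / s"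
    using b s by (auto simp: V_def log_well_grad_def s_def r_def dot_square_norm)
  have "V powr p \<le> 1 + V ^ n"
  proof (cases "V \<le> 1")
    case True
    then have "V powr p \<le> 1 powr p" using V p by (intro powr_mono2) auto
    then show ?thesis using V by (simp add: add_increasing2)
  next
    case False
    then have "V powr p \<le> V powr real n" using p by (intro powr_mono) (auto simp: n_def)
    then show ?thesis using False by (simp add: powr_realpow)
  qed
  moreover have "V ^ n * r ^ (n - 1) \<le> (2 * b) ^ n * (r / s)"
  proof -
    have "V ^ n * r ^ (n - 1) \<le> (2 * b * r / s) ^ n * r ^ (n - 1)"
      using V r by (intro mult_right_mono power_mono) auto
    also have "\<dots> = (2 * b) ^ n * ((r / s) * (r\<^sup>2 / s) ^ (n - 1))"
      using n by (cases n) (auto simp: power_mult_distrib power_divide power2_eq_square)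
    also have "\<dots> \<le> (2 * b) ^ n * ((r / s) * 1)"
      using b r s \<epsilon> by (intro mult_left_mono power_le_one) (auto simp: s_def divide_le_eq_1)
    finally show ?thesis by simp
  qed
  ultimately have "V powr p * r ^ (n - 1) \<le> (1 + V ^ n) * r ^ (n - 1)"
    using r by (intro mult_right_mono) auto
  also have "\<dots> \<le> r ^ (n - 1) + (2 * b) ^ n * (r / s)"
    using \<open>V ^ n * r ^ (n - 1) \<le> _\<close> by (simp add: distrib_right)
  finally show ?thesis by (simp add: V_def r_def s_def n_def)
qed

lemma log_well_Lp:
  assumes b: "0 \<le> b" "b \<le> 1" and \<epsilon>: "0 < \<epsilon>" "\<epsilon> < 1" and p: "1 \<le> p" "p \<le> real DIM('a::euclidean_space)"
    and crit: "b ^ DIM('a) * ln (1 / \<epsilon>) \<le> 1"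
  shows "in_Lp p UNIV (grad (log_well b \<epsilon>) :: 'a \<Rightarrow> 'a)"
    and "Lp_norm p UNIV (grad (log_well b \<epsilon>) :: 'a \<Rightarrow> 'a) \<le> (sphere_area TYPE('a) * (1 + 2 ^ DIM('a))) powr (1 / p)"
proof -
  define n where "n = DIM('a)"
  define W where "W = (log_well_grad b \<epsilon> :: 'a \<Rightarrow> 'a)"
  define f where "f x = norm (W x) powr p" for x
  define g where "g r = r ^ (n - 1) + (2 * b) ^ n * (r / (r\<^sup>2 + \<epsilon>))" for r
  \<comment> \<open>Its increment over [0, 1] contains b^n ln(1/\<epsilon>), the quantity that
    \<open>crit\<close> bounds.\<close>
  define G where "G r = r ^ n / real n + (2 * b) ^ n * (ln (r\<^sup>2 + \<epsilon>) / 2)" for r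
  have n: "0 < n" by (simp add: n_def)
  have W[measurable]: "W \<in> borel_measurable borel" unfolding W_def by (rule borel_log_well_grad)
  have f[measurable]: "f \<in> borel_measurable borel" unfolding f_def[abs_def] by measurable
  have G: "(G has_real_derivative g r) (at r)" for r
  proof -
    have pos: "0 < r\<^sup>2 + \<epsilon>" using \<epsilon> by (simp add: add_nonneg_pos)
    have "((\<lambda>r. r ^ n / real n) has_real_derivative (real n * r ^ (n - 1)) / real n) (at r)"
      by (auto intro!: derivative_eq_intros)
    moreover have "((\<lambda>r. (2 * b) ^ n * (ln (r\<^sup>2 + \<epsilon>) / 2)) has_real_derivative (2 * b) ^ n * (2 * r / (r\<^sup>2 + \<epsilon>) / 2)) (at r)"
      by (rule DERIV_cmult, rule DERIV_cdivide) (use pos in \<open>auto intro!: derivative_eq_intros\<close>)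
    moreover have "2 * r / (r\<^sup>2 + \<epsilon>) / 2 = r / (r\<^sup>2 + \<epsilon>)" using pos by (simp add: field_simps)
    ultimately show ?thesis unfolding G_def[abs_def] g_def using n
      by - (rule DERIV_cong, rule DERIV_add, assumption, assumption, simp only: nonzero_mult_div_cancel_left of_nat_eq_0_iff simp_thms)
  qed
  have f0: "f x = 0" if "1 < norm x" for x
  proof -
    have "1 < (norm x)\<^sup>2" using that by (simp add: one_less_power)
    then show ?thesis using \<epsilon> by (simp add: f_def W_def log_well_grad_def dot_square_norm)
  qed
  have gm: "g \<in> borel_measurable borel" unfolding g_def[abs_def] by measurable
  have fn: "0 \<le> f x" for x by (simp add: f_def)
  have g0: "0 \<le> g r" if "0 \<le> r" for r using that b \<epsilon> by (simp add: g_def)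
  have fg: "f x * norm x ^ (DIM('a) - 1) \<le> g (norm x)" for x :: 'a
    using log_well_grad_powr_le[OF b(1) \<epsilon>(1) p, of x] by (simp add: f_def W_def g_def n_def)
  note rad = radial_integrable[OF f fn f0 zero_le_one fg gm g0 G] radial_integral_le[OF f fn f0 zero_le_one fg gm g0 G]
  have ae: "AE x in lebesgue. grad (log_well b \<epsilon>) x = W x"
    unfolding W_def by (rule AE_grad_log_well[OF \<epsilon>])
  have f_leb: "integrable lebesgue f" using rad(1) f by (simp add: integrable_completion)
  have ae': "AE x in lebesgue. norm (grad (log_well b \<epsilon>) x) powr p = f x"
    using ae by eventually_elim (simp add: f_def)
  have "(grad (log_well b \<epsilon>) :: 'a \<Rightarrow> 'a) \<in> borel_measurable lebesgue"
    by (rule lebesgue_measurable_cong_AE[OF _ ae]) (intro measurable_completion, simp)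
  then show "in_Lp p UNIV (grad (log_well b \<epsilon>) :: 'a \<Rightarrow> 'a)"
    using lebesgue_integrable_cong_AE(1)[OF f_leb ae']
    by (simp add: in_Lp_def set_borel_measurable_def set_integrable_def)
  have "(LINT x|lebesgue. norm (grad (log_well b \<epsilon>) (x :: 'a)) powr p) = integral\<^sup>L lborel f"
    using lebesgue_integrable_cong_AE(2)[OF f_leb ae'] f by (simp add: integral_completion)
  also have "\<dots> \<le> sphere_area TYPE('a) * (G 1 - G 0)" by (rule rad(2))
  also have "\<dots> \<le> sphere_area TYPE('a) * (1 + 2 ^ n)"
  proof (rule mult_left_mono[OF _ sphere_area_nonneg])
    have l1: "ln (1 + \<epsilon>) \<le> 1" using ln_add_one_self_le_self[of \<epsilon>] \<epsilon> by simp
    have bn: "b ^ n \<le> 1" "0 \<le> b ^ n" using b by (auto simp: power_le_one)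
    have "b ^ n * ln (1 + \<epsilon>) \<le> 1 * 1" using l1 bn \<epsilon> by (intro mult_mono) auto
    moreover have "- (b ^ n * ln \<epsilon>) \<le> 1" using crit \<epsilon> by (simp add: ln_div n_def)
    ultimately have "b ^ n * ((ln (1 + \<epsilon>) - ln \<epsilon>) / 2) \<le> 1" by (simp add: algebra_simps)
    then have "2 ^ n * (b ^ n * ((ln (1 + \<epsilon>) - ln \<epsilon>) / 2)) \<le> 2 ^ n * 1" by (rule mult_left_mono) simp
    moreover have "1 / real n \<le> 1" using n by simp
    moreover have "G 1 - G 0 = 1 / real n + 2 ^ n * (b ^ n * ((ln (1 + \<epsilon>) - ln \<epsilon>) / 2))"
      using n by (simp add: G_def power_mult_distrib zero_power algebra_simps diff_divide_distrib)
    ultimately show "G 1 - G 0 \<le> 1 + 2 ^ n" by linarith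
  qed
  finally have le: "(LINT x|lebesgue. norm (grad (log_well b \<epsilon>) (x :: 'a)) powr p) \<le> sphere_area TYPE('a) * (1 + 2 ^ n)" .
  moreover have "0 \<le> (LINT x|lebesgue. norm (grad (log_well b \<epsilon>) (x :: 'a)) powr p)" by (rule integral_nonneg_AE) simp
  ultimately show "Lp_norm p UNIV (grad (log_well b \<epsilon>) :: 'a \<Rightarrow> 'a) \<le> (sphere_area TYPE('a) * (1 + 2 ^ DIM('a))) powr (1 / p)"
    using p unfolding Lp_norm_def set_lebesgue_integral_def n_def
    by (intro powr_mono2) auto
qed

section \<open>Blow-up\<close>

lemma power_exp_error_tendsto_0:
  fixes d k C :: real
  assumes d: "0 < d" and k: "0 < k"
  shows "(\<lambda>n. C * (d * k * real n) ^ N * exp (- (real n / (2 * k)))) \<longlonglongrightarrow> 0"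
proof -
  have "filterlim (\<lambda>n. (1 / (2 * k)) * real n) at_top sequentially"
    using k by (intro filterlim_tendsto_pos_mult_at_top[OF tendsto_const _ filterlim_real_sequentially]) simp
  then have "(\<lambda>n. poly (monom 1 N) ((1 / (2 * k)) * real n) * exp (- ((1 / (2 * k)) * real n))) \<longlonglongrightarrow> 0"
    by (rule filterlim_compose[OF tendsto_poly_exp])
  then have "(\<lambda>n. (C * (d * k * (2 * k)) ^ N) * (poly (monom 1 N) ((1 / (2 * k)) * real n) * exp (- ((1 / (2 * k)) * real n)))) \<longlonglongrightarrow> 0"
    by (rule tendsto_mult_right_zero)
  moreover have eq: "(C * (d * k * (2 * k)) ^ N) * (poly (monom 1 N) ((1 / (2 * k)) * real n) * exp (- ((1 / (2 * k)) * real n)))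
      = C * (d * k * real n) ^ N * exp (- (real n / (2 * k)))" for n
    using k by (simp add: poly_monom power_mult_distrib power_divide)
  ultimately show ?thesis by (simp only: eq)
qed

lemma integral_pos_if_continuous:
  fixes f :: "'a::euclidean_space \<Rightarrow> real"
  assumes f: "continuous_on UNIV f" "integrable lebesgue f" "\<And>x. 0 \<le> f x" "f x0 \<noteq> 0"
  shows "0 < (LINT x|lebesgue. f x)"
proof (rule ccontr)
  assume "\<not> ?thesis"
  moreover have "0 \<le> (LINT x|lebesgue. f x)" using f(3) by (intro integral_nonneg_AE) simp
  ultimately have "(LINT x|lebesgue. f x) = 0" by linarith
  then have "AE x in lebesgue. f x = 0"
    using integral_nonneg_eq_0_iff_AE[OF f(2)] f(3) by simp
  then have "negligible {x. f x \<noteq> 0}"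
    by (simp add: negligible_iff_null_sets completion.AE_iff_null_sets)
  moreover have "open {x. f x \<noteq> 0}"
    using open_Collect_neq[OF f(1) continuous_on_const] .
  ultimately show False using open_not_negligible f(4) by blast
qed

text \<open>The threshold for \<open>n\<close> is uniform over all solutions \<open>u\<close>. The
  weighted initial mass is at least \<open>y\<close>, and three errors of at most c q each
  contradict the growth estimate, which compares 8 q with 6 q.\<close>

lemma unbounded_in_deep_well:
  fixes u0 :: "'a::euclidean_space \<Rightarrow> real"
  assumes d: "DIM('a) \<ge> 2" and m: "1 < m" and M: "1 \<le> M"
    and u0: "smooth u0" "compact (supp u0)" "\<And>x. 0 \<le> u0 x" "u0 x0 \<noteq> 0"
  shows "\<forall>\<^sub>F n in sequentially. \<forall>u.
    weak_solution m (grad (log_well (1 / real n) (exp (- (real n ^ DIM('a)))))) u0 u \<longrightarrow>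
    \<not> (AE z in lebesgue. 0 < fst z \<longrightarrow> u (fst z) (snd z) \<le> M)"
proof -
  define D where "D = real DIM('a)"
  define A where "A = sphere_area TYPE('a)"
  define \<omega> where "\<omega> = unit_ball_vol (real DIM('a))"
  define k where "k = M powr (m - 1)"
  have D: "2 \<le> D" using d by (simp add: D_def)
  have A: "0 \<le> A" by (simp add: A_def sphere_area_nonneg)
  have k: "1 \<le> k" unfolding k_def using M m by (simp add: ge_one_powr_ge_zero)
  obtain B where B: "\<And>x. x \<in> supp u0 \<Longrightarrow> norm x \<le> B"
    using compact_imp_bounded[OF u0(2)] by (auto simp: bounded_iff)
  \<comment> \<open>On the support of \<open>u0\<close> this gives
    \<open>x \<bullet> x \<le> R - 2\<close>, the range in which \<open>H_ge\<close>
    applies.\<close>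
  define R where "R = B\<^sup>2 + 2"
  have R: "2 \<le> R" by (simp add: R_def)
  have u0_int: "integrable lebesgue u0"
    by (rule integrable_continuous_compact_support[OF smooth_continuous_on[OF u0(1)] u0(2)]) (rule notin_supp)
  define I0 where "I0 = (LINT x|lebesgue. u0 x)"
  have I0: "0 < I0" unfolding I0_def
    by (rule integral_pos_if_continuous[OF smooth_continuous_on[OF u0(1)] u0_int u0(3) u0(4)])
  \<comment> \<open>A lower bound for the initial weighted mass that is free of \<open>n\<close>:
    the exponent \<open>a\<close> is replaced by its upper bound \<open>D / 2\<close>.\<close>
  define y where "y = (R + 1) powr (- (D / 2)) * exp (- 1) * I0"
  define q where "q = exp (- 2) * y / 8"
  have q: "0 < q" using I0 R by (simp add: q_def y_def)
  define C where "C = A * (2 * (R + 1) * sqrt R)"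
  have C: "0 \<le> C" using A R by (simp add: C_def)
  define \<eta> where "\<eta> = q / (C * sqrt R + 1)"
  have \<eta>: "0 < \<eta>" "\<eta> * (C * sqrt R) \<le> q"
  proof -
    have X: "0 \<le> C * sqrt R" using C R by simp
    then show "0 < \<eta>" using q by (simp add: \<eta>_def add_nonneg_pos)
    have "q * (C * sqrt R) \<le> q * (C * sqrt R + 1)" using q by simp
    then show "\<eta> * (C * sqrt R) \<le> q" using X by (simp add: \<eta>_def pos_divide_le_eq add_nonneg_pos)
  qed
  define \<delta> where "\<delta> = (q / (M * C + 1))\<^sup>2"
  have MC: "0 < M * C + 1" using M C by (simp add: add_nonneg_pos)
  have \<delta>: "0 < \<delta>" "M * (C * sqrt \<delta>) \<le> q"
  proof -
    show "0 < \<delta>" using q MC by (simp add: \<delta>_def)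
    have "sqrt \<delta> = q / (M * C + 1)" using q MC by (simp add: \<delta>_def)
    moreover have "q * (M * C) \<le> q * (M * C + 1)" using q by simp
    ultimately show "M * (C * sqrt \<delta>) \<le> q" using MC by (simp add: pos_divide_le_eq mult_ac)
  qed
  define c where "c = 2 * \<delta> * \<eta> powr (m - 1) / R ^ 3"
  have c: "0 < c" using \<delta> \<eta> R by (simp add: c_def)
  \<comment> \<open>An upper bound for the integral of the core error, derived below; its
    exponential comes from \<open>\<epsilon> powr al\<close>.\<close>
  define err where "err n = (2 * D * k * M * \<omega>) * (D * k * real n) ^ DIM('a) * exp (- (real n / (2 * k)))" for n :: nat
  have "(\<lambda>n. 1 / real n) \<longlonglongrightarrow> 0" by (rule lim_1_over_n)
  moreover have "0 < min (k / (2 * R\<^sup>2)) 1" using k R by simp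
  \<comment> \<open>The bound k/(2 R^2) on b is exactly \<open>4 * al \<le> 1 / R\<^sup>2\<close>;
    the bounds of \<open>ev2\<close> on \<open>\<epsilon>\<close> likewise serve the conditions of
    \<open>weighted_lap_profile_ge\<close>.\<close>
  ultimately have ev1: "\<forall>\<^sub>F n in sequentially. 1 / real n < min (k / (2 * R\<^sup>2)) 1"
    by (rule order_tendstoD(2))
  have "(\<lambda>n. exp (- 1 :: real) ^ n) \<longlonglongrightarrow> 0" by (intro LIMSEQ_power_zero) simp
  moreover have "0 < min (1 / (4 * D * R\<^sup>2)) (1 / 2)" using D R by simp
  ultimately have ev2: "\<forall>\<^sub>F n in sequentially. exp (- 1 :: real) ^ n < min (1 / (4 * D * R\<^sup>2)) (1 / 2)"
    by (rule order_tendstoD(2))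
  have "err \<longlonglongrightarrow> 0" unfolding err_def using D k by (intro power_exp_error_tendsto_0) auto
  moreover have "0 < q * c" using q c by simp
  ultimately have ev3: "\<forall>\<^sub>F n in sequentially. err n < q * c" by (rule order_tendstoD(2))
  show ?thesis
    using ev1 ev2 ev3 eventually_ge_at_top[of 1]
  proof eventually_elim
    case (elim n)
    define b where "b = 1 / real n"
    define \<epsilon> where "\<epsilon> = exp (- (real n ^ DIM('a)))"
    define al where "al = b / (2 * k)"
    define a where "a = D / 2 - al"
    have n: "1 \<le> real n" using elim(4) by simp
    have b: "0 < b" "b \<le> 1" "b \<le> k / (2 * R\<^sup>2)" using n elim(1) by (auto simp: b_def)
    have al: "0 \<le> al" "al \<le> 1" "4 * al \<le> 1 / R\<^sup>2"
    proof -
      show "0 \<le> al" using b k by (simp add: al_def)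
      have "b \<le> 1 * (2 * k)" using b k by simp
      then show "al \<le> 1" using k by (simp add: al_def field_simps)
      have "2 * b / k \<le> 2 * (k / (2 * R\<^sup>2)) / k" using b k by (intro divide_right_mono mult_left_mono) auto
      then show "4 * al \<le> 1 / R\<^sup>2" using k by (simp add: al_def)
    qed
    have \<epsilon>_le: "\<epsilon> \<le> exp (- 1) ^ n"
    proof -
      have "real n ^ 1 \<le> real n ^ DIM('a)" using n d by (intro power_increasing) auto
      then have "\<epsilon> \<le> exp (real n * (- 1))" by (simp add: \<epsilon>_def)
      then show ?thesis by (simp only: exp_of_nat_mult)
    qed
    have eps: "0 < \<epsilon>" "\<epsilon> \<le> 1 / 2" "4 * D * \<epsilon> \<le> 1 / R\<^sup>2"
    proof -
      show "0 < \<epsilon>" by (simp add: \<epsilon>_def)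
      show "\<epsilon> \<le> 1 / 2" using \<epsilon>_le elim(2) by simp
      have "4 * D * \<epsilon> \<le> 4 * D * (1 / (4 * D * R\<^sup>2))" using \<epsilon>_le elim(2) D by (intro mult_left_mono) auto
      then show "4 * D * \<epsilon> \<le> 1 / R\<^sup>2" using D by simp
    qed
    interpret test_profile a \<epsilon> R
      using al D eps R by unfold_locales (auto simp: a_def)
    have aD: "a = real DIM('a) / 2 - al" by (simp add: a_def D_def)
    have e1: "\<epsilon> \<le> 1" using eps(2) by linarith
    have \<delta>0: "0 \<le> \<delta>" using \<delta> by simp
    define \<rho> where "\<rho> = D * \<epsilon> * k / b"
    have \<rho>: "0 < \<rho>" using D eps k b by (simp add: \<rho>_def)
    define K where "K = 2 * D * k * M * \<epsilon> powr (- a)"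
    have K: "0 \<le> K" using D k M by (simp add: K_def)
    \<comment> \<open>The three losses: small values of the solution, a small ball around the
      origin, and the core of the well, |x|^2 < \<open>\<rho>\<close>.\<close>
    define E where "E x = (c * \<eta>) * \<psi> x + (c * M) * (if x \<bullet> x < \<delta> then \<psi> x else 0) + K * indicator (ball 0 (sqrt \<rho>)) x" for x :: 'a
    have ball: "indicator (ball 0 (sqrt \<rho>)) x = (if x \<bullet> x < \<rho> then 1 else 0 :: real)" for x :: 'a
      by (simp add: indicator_def norm_eq_sqrt_inner)
    have iball: "integrable lborel (indicator (ball (0::'a) (sqrt \<rho>)) :: 'a \<Rightarrow> real)"
      using emeasure_lborel_ball_finite[of "0 :: 'a" "sqrt \<rho>"] by (simp add: integrable_indicator_iff)
    note psi_int = \<psi>_integrable[OF al(1,2) aD e1] \<psi>_integrable_ball[OF al(1,2) aD e1 \<delta>0]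
    have E_int: "integrable lborel E" unfolding E_def
      by (intro Bochner_Integration.integrable_add integrable_mult_right psi_int iball)
    have E0: "0 \<le> E x" for x
      unfolding E_def using c \<eta> M K \<psi>_nonneg[of x] by simp
    have "(LINT x|lborel. E x) = (c * \<eta>) * (LINT x|lborel. \<psi> (x :: 'a))
        + (c * M) * (LINT x|lborel. (if x \<bullet> (x :: 'a) < \<delta> then \<psi> x else 0)) + K * measure lborel (ball (0 :: 'a) (sqrt \<rho>))"
      unfolding E_def using psi_int iball by simp
    also have "\<dots> \<le> (c * \<eta>) * (C * sqrt R) + (c * M) * (C * sqrt \<delta>) + err n"
    proof (intro add_mono mult_left_mono)
      show "(LINT x|lborel. \<psi> (x :: 'a)) \<le> C * sqrt R"
        using \<psi>_integral_le[OF al(1,2) aD e1] by (simp only: C_def A_def mult.assoc)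
      show "(LINT x|lborel. (if x \<bullet> (x :: 'a) < \<delta> then \<psi> x else 0)) \<le> C * sqrt \<delta>"
        using \<psi>_integral_ball_le[OF al(1,2) aD e1 \<delta>0] by (simp only: C_def A_def mult.assoc)
      have "measure lborel (ball (0 :: 'a) (sqrt \<rho>)) = \<omega> * sqrt \<rho> ^ DIM('a)"
        using \<rho> by (simp add: content_ball \<omega>_def)
      also have "sqrt \<rho> ^ DIM('a) = \<rho> powr (D / 2)"
      proof -
        have "sqrt \<rho> ^ DIM('a) = sqrt \<rho> powr D" using \<rho> by (simp add: D_def powr_realpow)
        also have "\<dots> = (\<rho> powr (1 / 2)) powr D" using \<rho> by (simp only: powr_half_sqrt less_imp_le)
        also have "\<dots> = \<rho> powr (D / 2)" by (simp add: powr_powr)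
        finally show ?thesis .
      qed
      also have "\<rho> powr (D / 2) = \<epsilon> powr (D / 2) * (D * k * real n) powr (D / 2)"
      proof -
        have "\<rho> = \<epsilon> * (D * k * real n)" by (simp add: \<rho>_def b_def)
        then show ?thesis by (simp only: powr_mult)
      qed
      also have "\<dots> \<le> \<epsilon> powr (D / 2) * (D * k * real n) ^ DIM('a)"
      proof (rule mult_left_mono)
        have "1 * 1 \<le> D * k" using D k by (intro mult_mono) auto
        then have "1 * 1 \<le> D * k * real n" using n by (intro mult_mono) auto
        then have "(D * k * real n) powr (D / 2) \<le> (D * k * real n) powr D"
          using D by (intro powr_mono) auto
        then show "(D * k * real n) powr (D / 2) \<le> (D * k * real n) ^ DIM('a)"
          using \<open>1 * 1 \<le> D * k * real n\<close> by (simp add: D_def powr_realpow)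
      qed simp
      finally have "K * measure lborel (ball (0 :: 'a) (sqrt \<rho>)) \<le> K * (\<omega> * (\<epsilon> powr (D / 2) * (D * k * real n) ^ DIM('a)))"
        using K by (simp add: mult_left_mono \<omega>_def)
      also have "\<dots> = (2 * D * k * M * \<omega>) * (D * k * real n) ^ DIM('a) * (\<epsilon> powr (- a) * \<epsilon> powr (D / 2))"
        by (simp add: K_def)
      \<comment> \<open>The volume of the core compensates the height of the profile up to the
        offset \<open>al\<close>. As \<open>al\<close> is 1/(2 k n) and -ln \<epsilon> = n^d, what
        remains is exp(-n^(d-1)/(2 k)), and d \<ge> 2 makes it decay.\<close>
      also have "\<epsilon> powr (- a) * \<epsilon> powr (D / 2) = \<epsilon> powr al" by (simp add: a_def powr_add[symmetric])
      also have "\<dots> \<le> exp (- (real n / (2 * k)))"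
      proof -
        have "real n ^ 2 \<le> real n ^ DIM('a)" using n d by (intro power_increasing) auto
        then have "real n ^ 2 * al \<le> real n ^ DIM('a) * al" using al by (intro mult_right_mono) auto
        moreover have "real n ^ 2 * al = real n / (2 * k)" using n by (simp add: al_def b_def power2_eq_square)
        moreover have "\<epsilon> powr al = exp (- (real n ^ DIM('a) * al))" by (simp add: \<epsilon>_def powr_def mult.commute)
        ultimately show ?thesis by simp
      qed
      finally show "K * measure lborel (ball (0 :: 'a) (sqrt \<rho>)) \<le> err n"
        unfolding err_def using D k M by (simp add: \<omega>_def mult_left_mono)
    qed (use c \<eta> M in auto)
    also have "\<dots> \<le> c * q + c * q + c * q"
    proof -
      have "c * (\<eta> * (C * sqrt R)) \<le> c * q" "c * (M * (C * sqrt \<delta>)) \<le> c * q"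
        using \<eta> \<delta> c by (auto intro: mult_left_mono)
      then show ?thesis using elim(3) by (simp add: mult_ac)
    qed
    finally have E_le: "2 / c * (LINT x|lborel. E x) \<le> 6 * q"
      using c by (simp add: field_simps)
    show ?case
    proof (intro allI impI notI)
      fix u
      assume ws: "weak_solution m (grad (log_well (1 / real n) (exp (- (real n ^ DIM('a)))))) u0 u"
        and bd: "AE z in lebesgue. 0 < fst z \<longrightarrow> u (fst z) (snd z) \<le> M"
      have ws': "weak_solution m (grad (log_well b \<epsilon>)) u0 u" using ws by (simp add: b_def \<epsilon>_def)
      have "\<epsilon> < 1" using eps(2) by linarith
      from AE_grad_log_well[OF eps(1) this, of b, where 'a='a]
      have key: "AE x in lebesgue. \<forall>w. 0 \<le> w \<and> w \<le> M \<longrightarrow>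
          c * w * \<psi> x - E x \<le> w powr m * lap \<psi> x - w * (grad (log_well b \<epsilon>) x \<bullet> grad \<psi> x)"
      proof eventually_elim
        case (elim x)
        show ?case
        proof (intro allI impI)
          fix w assume w: "0 \<le> w \<and> w \<le> M"
          define \<sigma> where "\<sigma> = x \<bullet> x"
          have \<sigma>: "0 \<le> \<sigma>" by (simp add: \<sigma>_def)
          have drift: "- w * (grad (log_well b \<epsilon>) x \<bullet> grad \<psi> x)
              = w * (if \<sigma> + \<epsilon> < 1 then 4 * b * \<sigma> * P \<sigma> / (\<sigma> + \<epsilon>) else 0)"
            by (simp add: elim log_well_grad_def grad_\<psi> \<sigma>_def)
          have f1: "c * w * H \<sigma> - (c * \<eta> * H \<sigma> + (if \<sigma> < \<delta> then c * M * H \<sigma> else 0)) \<le> 2 / R\<^sup>2 * \<sigma> * w powr m * P \<sigma>"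
            unfolding c_def using dissipation_ge_growth[OF \<delta>(1) \<eta>(1) m _ _ \<sigma>] w by blast
          have f2: "2 / R\<^sup>2 * \<sigma> * w powr m * P \<sigma> - (if \<sigma> < D * \<epsilon> * k / b then 2 * D * k * M * \<epsilon> powr (- a) else 0)
              \<le> w powr m * - (4 * \<sigma> * P' \<sigma> + 2 * D * P \<sigma>)
                + w * (if \<sigma> + \<epsilon> < 1 then 4 * b * \<sigma> * P \<sigma> / (\<sigma> + \<epsilon>) else 0)"
            by (rule weighted_lap_profile_ge[OF a_def al_def al(3) b(1) _ _ eps(3,2) m _ _ _ \<sigma>])
              (use k D w in \<open>auto simp: k_def\<close>)
          have eE: "E x = (c * \<eta> * H \<sigma> + (if \<sigma> < \<delta> then c * M * H \<sigma> else 0))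
              + (if \<sigma> < D * \<epsilon> * k / b then 2 * D * k * M * \<epsilon> powr (- a) else 0)"
            unfolding E_def ball by (simp add: \<psi>_def \<sigma>_def \<rho>_def K_def)
          have eP: "\<psi> x = H \<sigma>" by (simp add: \<psi>_def \<sigma>_def)
          have eL: "lap \<psi> x = - (4 * \<sigma> * P' \<sigma> + 2 * D * P \<sigma>)" by (simp add: lap_\<psi> \<sigma>_def D_def)
          show "c * w * \<psi> x - E x \<le> w powr m * lap \<psi> x - w * (grad (log_well b \<epsilon>) x \<bullet> grad \<psi> x)"
            unfolding eE eP eL using f1 f2 drift by linarith
        qed
      qed
      have up: "exp (- 2) * (LINT x|lebesgue. u0 x * \<psi> x) \<le> 2 / c * (LINT x|lborel. E x)"
        using weak_solution_growth_estimate[OF ws' _ bd u0(3) smooth_\<psi> compact_supp_\<psi> \<psi>_nonneg E_int E0 c key] m by simp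
      have "y \<le> (LINT x|lebesgue. u0 x * \<psi> x)"
      proof -
        have "y = (LINT x|lebesgue. u0 x * ((R + 1) powr (- (D / 2)) * exp (- 1)))"
          by (simp add: y_def I0_def mult_ac)
        also have "\<dots> \<le> (LINT x|lebesgue. u0 x * \<psi> x)"
        proof (rule integral_mono)
          show "integrable lebesgue (\<lambda>x. u0 x * ((R + 1) powr (- (D / 2)) * exp (- 1)))" using u0_int by simp
          show "integrable lebesgue (\<lambda>x. u0 x * \<psi> x)"
            by (rule integrable_continuous_compact_support[OF smooth_continuous_on[OF smooth_mult[OF u0(1) smooth_\<psi>]] u0(2)])
              (simp add: notin_supp)
          fix x
          show "u0 x * ((R + 1) powr (- (D / 2)) * exp (- 1)) \<le> u0 x * \<psi> x"
          proof (cases "x \<in> supp u0")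
            case True
            have "x \<bullet> x \<le> B\<^sup>2" using B[OF True] by (simp add: dot_square_norm power_mono)
            then have "(R + 1) powr (- a) * exp (- 1) \<le> \<psi> x"
              unfolding \<psi>_def by (intro H_ge e1) (auto simp: R_def)
            moreover have "(R + 1) powr (- (D / 2)) \<le> (R + 1) powr (- a)"
              using R al by (intro powr_mono) (auto simp: a_def)
            ultimately have "(R + 1) powr (- (D / 2)) * exp (- 1) \<le> \<psi> x"
              by (meson exp_ge_zero mult_right_mono order_trans)
            then show ?thesis using u0(3) by (rule mult_left_mono)
          qed (simp add: notin_supp)
        qed
        finally show ?thesis .
      qed
      then have "exp (- 2) * y \<le> exp (- 2) * (LINT x|lebesgue. u0 x * \<psi> x)"
        by (rule mult_left_mono) simp
      moreover have "exp (- 2) * y = 8 * q" by (simp add: q_def)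
      ultimately show False using up E_le q by linarith
    qed
  qed
qed

theorem theorem5p2:
  fixes m p :: real
  assumes "CARD('d::finite) \<ge> 2" and "m > 1" and "1 \<le> p" and "p \<le> real CARD('d)"
  shows "\<exists>\<Phi> :: nat \<Rightarrow> real ^ 'd \<Rightarrow> real.
    (\<forall>A. \<exists>L. L-lipschitz_on UNIV (\<Phi> A)) \<and>
    (\<exists>C. \<forall>A. in_Lp p UNIV (grad (\<Phi> A)) \<and> Lp_norm p UNIV (grad (\<Phi> A)) \<le> C) \<and>
    (\<forall>(u0 :: real ^ 'd \<Rightarrow> real) (u :: nat \<Rightarrow> real \<Rightarrow> real ^ 'd \<Rightarrow> real).
       smooth u0 \<and> compact (supp u0) \<and> (\<forall>x. 0 \<le> u0 x) \<and> (\<exists>x. u0 x \<noteq> 0) \<and>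
       (\<forall>A. weak_solution m (grad (\<Phi> A)) u0 (u A)) \<longrightarrow>
       (\<lambda>A. sup_positive_times (u A)) \<longlonglongrightarrow> \<infinity>)"
proof -
  let ?d = "DIM(real ^ 'd)"
  define \<Psi> :: "nat \<Rightarrow> real ^ 'd \<Rightarrow> real" where
    "\<Psi> n = log_well (1 / real n) (exp (- (real n ^ ?d)))" for n
  have d: "?d = CARD('d)" by simp
  \<comment> \<open>The shift to \<open>Suc A\<close> skips the index 0, for which
    \<open>\<epsilon>\<close> would be 1.\<close>
  show ?thesis
  proof (intro exI[of _ "\<lambda>A. \<Psi> (Suc A)"] conjI allI impI)
    fix A
    have "\<exists>L. L-lipschitz_on UNIV (\<Psi> (Suc A))"
      unfolding \<Psi>_def by (rule exI, rule log_well_lipschitz) auto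
    then show "\<exists>L. L-lipschitz_on UNIV (\<Psi> (Suc A))" .
  next
    have "in_Lp p UNIV (grad (\<Psi> (Suc A))) \<and>
        Lp_norm p UNIV (grad (\<Psi> (Suc A))) \<le> (sphere_area TYPE(real ^ 'd) * (1 + 2 ^ ?d)) powr (1 / p)" for A
    proof -
      \<comment> \<open>Equality holds: \<open>\<epsilon>\<close> is chosen to make the critical
        quantity b^d ln(1/\<epsilon>) equal to 1.\<close>
      have crit: "(1 / real (Suc A)) ^ ?d * ln (1 / exp (- (real (Suc A) ^ ?d))) \<le> 1"
        by (simp only: ln_div ln_exp exp_gt_zero ln_one) (simp add: power_divide)
      show ?thesis unfolding \<Psi>_def
        by (intro conjI log_well_Lp[OF _ _ _ _ assms(3) _ crit]) (use assms in auto)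
    qed
    then show "\<exists>C. \<forall>A. in_Lp p UNIV (grad (\<Psi> (Suc A))) \<and> Lp_norm p UNIV (grad (\<Psi> (Suc A))) \<le> C" by blast
  next
    fix u0 :: "real ^ 'd \<Rightarrow> real" and u :: "nat \<Rightarrow> real \<Rightarrow> real ^ 'd \<Rightarrow> real"
    assume u0: "smooth u0 \<and> compact (supp u0) \<and> (\<forall>x. 0 \<le> u0 x) \<and> (\<exists>x. u0 x \<noteq> 0) \<and>
       (\<forall>A. weak_solution m (grad (\<Psi> (Suc A))) u0 (u A))"
    then obtain x0 where x0: "u0 x0 \<noteq> 0" by blast
    show "(\<lambda>A. sup_positive_times (u A)) \<longlonglongrightarrow> \<infinity>"
    proof (rule tendsto_PInfty[THEN iffD2], intro allI)
      fix r :: real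
      \<comment> \<open>The preceding lemma asks for a bound of at least 1; raising \<open>r\<close>
        only weakens the assumed bound on the solution.\<close>
      define M where "M = max 1 r"
      have "\<forall>\<^sub>F n in sequentially. \<forall>v. weak_solution m (grad (\<Psi> n)) u0 v \<longrightarrow>
          \<not> (AE z in lebesgue. 0 < fst z \<longrightarrow> v (fst z) (snd z) \<le> M)"
        unfolding \<Psi>_def by (rule unbounded_in_deep_well[where ?x0.0=x0]) (use u0 x0 assms in \<open>auto simp: M_def\<close>)
      then have "\<forall>\<^sub>F A in sequentially. \<forall>v. weak_solution m (grad (\<Psi> (Suc A))) u0 v \<longrightarrow>
          \<not> (AE z in lebesgue. 0 < fst z \<longrightarrow> v (fst z) (snd z) \<le> M)"
        by (rule eventually_compose_filterlim[OF _ filterlim_Suc])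
      then show "\<forall>\<^sub>F A in sequentially. ereal r < sup_positive_times (u A)"
      proof eventually_elim
        case (elim A)
        show ?case
        proof (rule ccontr)
          assume "\<not> ?case"
          then have le: "sup_positive_times (u A) \<le> ereal r" by simp
          let ?S = "{0<..} \<times> UNIV :: (real \<times> (real ^ 'd)) set"
          have S: "?S \<in> sets lebesgue"
            by (intro sets_completionI_sets) (simp add: open_Times borel_open)
          have "AE z in restrict_space lebesgue ?S. (case z of (t, x) \<Rightarrow> ereal (u A t x)) \<le> sup_positive_times (u A)"
            unfolding sup_positive_times_def by (rule esssup_AE)
          then have "AE z in lebesgue. z \<in> ?S \<longrightarrow> (case z of (t, x) \<Rightarrow> ereal (u A t x)) \<le> sup_positive_times (u A)"
            using S by (simp add: AE_restrict_space_iff)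
          then have "AE z in lebesgue. 0 < fst z \<longrightarrow> u A (fst z) (snd z) \<le> M"
          proof eventually_elim
            case (elim z)
            show ?case
            proof
              assume "0 < fst z"
              then have "ereal (u A (fst z) (snd z)) \<le> sup_positive_times (u A)"
                using elim by (simp add: mem_Times_iff case_prod_unfold)
              also have "\<dots> \<le> ereal r" by (rule le)
              finally show "u A (fst z) (snd z) \<le> M" by (simp add: M_def)
            qed
          qed
          then show False using elim u0 by blast
        qed
      qed
    qed
  qed
qed

end
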